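(* Let $d,n$ be positive integers and let $F_{d,n}=F_{d,n}(l,m,y_0,\ldots,y_{d-1})$ be the $d$-framization of the BMW algebra, with generators $g_i,h_i$ ($1\le i\le n-1$) and $t_j$ ($1\le j\le n$). For every $i$ with $1\le i\le n-1$, the element $g_i$ satisfies the quartic relation $$g_i^4+m\,g_i^3+(m-2)\,g_i^2+m(m-1)\,g_i-(m-1)=m\,l^{-1}\left(m+l^{-2}-1\right)h_i ,$$ and this relation is of minimal degree among the relations not containing the generators $t_j$ (that is, there is no relation in $F_{d,n}$ of the form $p(g_i)=c\,h_i$ with $c\in K$ and $p\in K[x]$ a nonzero polynomial of degree less than $4$). Also, $g_i$ satisfies (with $x=g_i$) the closed quintic equation $$\left(x-l^{-1}\right)\left(x^4+m\,x^3+(m-2)\,x^2+m(m-1)\,x-(m-1)\right)=0 ,$$ and this equation is of minimal degree among those not containing the generators $t_j$ and $h_j$ (that is, there is no nonzero $p\in K[x]$ of degree less than $5$ with $p(g_i)=0$ in $F_{d,n}$). Moreover $$x^4+m\,x^3+(m-2)\,x^2+m(m-1)\,x-(m-1)=(x^2+m\,x-1)(x^2+m-1).$$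
   Context: Let $K=\mathbb{C}(l,m)$ be the field of rational functions in two indeterminates $l,m$, and put $y:=1+\frac{l^{-1}-l}{m}\in K$. Let $d,n$ be positive integers, $y_0:=y$, and let $y_1,\ldots,y_{d-1}$ be unspecified parameters (fixed scalars in the ground field). The algebra $F_{d,n}=F_{d,n}(l,m,y_0,\ldots,y_{d-1})$ is the unital associative $K$-algebra with generators $g_1,\ldots,g_{n-1}$, $h_1,\ldots,h_{n-1}$, $t_1,\ldots,t_n$ and the following defining relations (for all indices for which they make sense): - $g_ig_{i+1}g_i=g_{i+1}g_ig_{i+1}$, and $g_ig_j=g_jg_i$ for $|i-j|>1$; - $g_ih_i=l^{-1}h_i$; - $h_ig_{i\pm1}h_i=l\,h_i$; - $t_i^d=1$ and $t_it_j=t_jt_i$ for all $i,j$; - $t_ih_i=t_{i+1}h_i$ and $h_it_i=h_it_{i+1}$; - $h_it_i^kh_i=y_kh_i$ for $0\le k\le d-1$; - $t_jg_i=g_it_{s_i(j)}$ for all $i,j$, where $s_i$ is the transposition $(i,i+1)$; - $g_i^2=(1-m)-m\,e_i(g_i-1)+m\,l^{-1}h_i$, where $e_i:=\frac1d\sum_{s=0}^{d-1}t_i^s t_{i+1}^{-s}$.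
   Formalization: Minimality is claimed only for d ≥ 2 (for d = 1, g_i^2 + m g_i - 1 = m l^{-1} h_i has lower degree); quintic minimality also only if y_k = ζ^k y_0 (0 ≤ k < d) for some ζ in K with ζ^d = 1, since otherwise h_i = 0 and the quartic annihilates g_i. *)

theory Defs
  imports
    "HOL-Algebra.QuotRing"
    "HOL-Combinatorics.Transposition"
    "HOL-Computational_Algebra.Polynomial"
    "HOL-Computational_Algebra.Fraction_Field"
    "HOL-Library.Poly_Mapping"
begin

text \<open>The inner variable is \<open>l\<close>, the outer one is \<open>m\<close>.\<close>

type_synonym K = "complex poly poly fract"

definition l\<^sub>K :: K where "l\<^sub>K = Fract [:[:0, 1:]:] 1"
definition m\<^sub>K :: K where "m\<^sub>K = Fract [:0, 1:] 1"

definition y\<^sub>K :: K where "y\<^sub>K = 1 + (inverse l\<^sub>K - l\<^sub>K) / m\<^sub>K"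

text \<open>
  Words over an alphabet, written additively, so that the convolution product of
  \<^theory>\<open>HOL-Library.Poly_Mapping\<close> on finitely supported functions \<open>'a word \<Rightarrow>\<^sub>0 K\<close> is the
  product of the free associative algebra.
\<close>

datatype 'a word = Word (letters: "'a list")

instantiation word :: (type) monoid_add
begin

definition zero_word :: "'a word" where "0 = Word []"
definition plus_word :: "'a word \<Rightarrow> 'a word \<Rightarrow> 'a word"
  where "u + v = Word (letters u @ letters v)"

instance
  by standard (simp_all add: zero_word_def plus_word_def)

end

datatype gen = G nat | H nat | T nat

type_synonym free_elem = "gen word \<Rightarrow>\<^sub>0 K"

definition const :: "K \<Rightarrow> free_elem" where "const c = Poly_Mapping.single 0 c"
definition letter :: "gen \<Rightarrow> free_elem" where "letter x = Poly_Mapping.single (Word [x]) 1"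

abbreviation g :: "nat \<Rightarrow> free_elem" where "g i \<equiv> letter (G i)"
abbreviation h :: "nat \<Rightarrow> free_elem" where "h i \<equiv> letter (H i)"
abbreviation t :: "nat \<Rightarrow> free_elem" where "t j \<equiv> letter (T j)"

definition gens :: "nat \<Rightarrow> gen set"
  where "gens n = G ` {1..<n} \<union> H ` {1..<n} \<union> T ` {1..n}"

definition free_algebra :: "nat \<Rightarrow> free_elem ring"
  where "free_algebra n =
    \<lparr> carrier = {a. \<forall>w \<in> Poly_Mapping.keys a. set (letters w) \<subseteq> gens n},
      monoid.mult = (*), one = 1, zero = 0, add = (+) \<rparr>"

text \<open>Since \<open>t\<^sub>j\<^sup>d = 1\<close> is among the relations, \<open>t\<^sub>j\<^sup>-\<^sup>s\<close> is written \<open>t\<^sub>j\<^sup>d\<^sup>-\<^sup>s\<close>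
  (\<open>0 \<le> s < d\<close>), there being no inverses in the free algebra.\<close>

definition e :: "nat \<Rightarrow> nat \<Rightarrow> free_elem"
  where "e d i = const (1 / of_nat d) * (\<Sum>s<d. t i ^ s * t (i + 1) ^ (d - s))"

inductive framization_rel ::
    "nat \<Rightarrow> nat \<Rightarrow> (nat \<Rightarrow> K) \<Rightarrow> free_elem \<Rightarrow> free_elem \<Rightarrow> bool"
  for d n :: nat and y :: "nat \<Rightarrow> K"
where
  braid: "1 \<le> i \<Longrightarrow> i + 1 < n \<Longrightarrow>
    framization_rel d n y (g i * g (i + 1) * g i) (g (i + 1) * g i * g (i + 1))"
| far_comm: "1 \<le> i \<Longrightarrow> i < n \<Longrightarrow> 1 \<le> j \<Longrightarrow> j < n \<Longrightarrow> \<bar>int i - int j\<bar> > 1 \<Longrightarrow>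
    framization_rel d n y (g i * g j) (g j * g i)"
| gh: "1 \<le> i \<Longrightarrow> i < n \<Longrightarrow>
    framization_rel d n y (g i * h i) (const (inverse l\<^sub>K) * h i)"
| hgh_right: "1 \<le> i \<Longrightarrow> i + 1 < n \<Longrightarrow>
    framization_rel d n y (h i * g (i + 1) * h i) (const l\<^sub>K * h i)"
| hgh_left: "1 \<le> i \<Longrightarrow> i + 1 < n \<Longrightarrow>
    framization_rel d n y (h (i + 1) * g i * h (i + 1)) (const l\<^sub>K * h (i + 1))"
| t_order: "1 \<le> j \<Longrightarrow> j \<le> n \<Longrightarrow>
    framization_rel d n y (t j ^ d) 1"
| t_comm: "1 \<le> i \<Longrightarrow> i \<le> n \<Longrightarrow> 1 \<le> j \<Longrightarrow> j \<le> n \<Longrightarrow>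
    framization_rel d n y (t i * t j) (t j * t i)"
| th: "1 \<le> i \<Longrightarrow> i < n \<Longrightarrow>
    framization_rel d n y (t i * h i) (t (i + 1) * h i)"
| ht: "1 \<le> i \<Longrightarrow> i < n \<Longrightarrow>
    framization_rel d n y (h i * t i) (h i * t (i + 1))"
| hth: "1 \<le> i \<Longrightarrow> i < n \<Longrightarrow> k < d \<Longrightarrow>
    framization_rel d n y (h i * t i ^ k * h i) (const (y k) * h i)"
| tg: "1 \<le> i \<Longrightarrow> i < n \<Longrightarrow> 1 \<le> j \<Longrightarrow> j \<le> n \<Longrightarrow>
    framization_rel d n y (t j * g i) (g i * t (transpose i (i + 1) j))"
| g_square: "1 \<le> i \<Longrightarrow> i < n \<Longrightarrow>
    framization_rel d n y (g i ^ 2)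
      (const (1 - m\<^sub>K) - const m\<^sub>K * e d i * (g i - 1) + const (m\<^sub>K * inverse l\<^sub>K) * h i)"

definition framization_ideal :: "nat \<Rightarrow> nat \<Rightarrow> (nat \<Rightarrow> K) \<Rightarrow> free_elem set"
  where "framization_ideal d n y =
    genideal (free_algebra n) {a - b | a b. framization_rel d n y a b}"

definition framization :: "nat \<Rightarrow> nat \<Rightarrow> (nat \<Rightarrow> K) \<Rightarrow> free_elem set ring"
  where "framization d n y = free_algebra n Quot framization_ideal d n y"

definition cls :: "nat \<Rightarrow> nat \<Rightarrow> (nat \<Rightarrow> K) \<Rightarrow> free_elem \<Rightarrow> free_elem set"
  where "cls d n y a = framization_ideal d n y +>\<^bsub>free_algebra n\<^esub> a"

text \<open>The value of \<open>p \<in> K[x]\<close> at an element of a \<open>K\<close>-algebra \<open>R\<close> with structure map \<open>s\<close>.\<close>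

definition poly_at :: "('r, 'b) ring_scheme \<Rightarrow> (K \<Rightarrow> 'r) \<Rightarrow> K poly \<Rightarrow> 'r \<Rightarrow> 'r"
  where "poly_at R s p a = (\<Oplus>\<^bsub>R\<^esub>k\<in>{..degree p}. s (coeff p k) \<otimes>\<^bsub>R\<^esub> a [^]\<^bsub>R\<^esub> k)"

hide_const (open) g h t e

end

theory Submission
  imports Defs "HOL-Algebra.Algebraic_Closure_Type"
begin

text \<open>
  Write \<open>x = g\<^sub>i\<close>, \<open>h = h\<^sub>i\<close>, \<open>e = e\<^sub>i\<close>, \<open>u = l\<^sup>-\<^sup>1\<close>. The element \<open>e\<close> is an idempotent that commutes with \<open>x\<close>
  and fixes \<open>h\<close> (\<open>idem_idem\<close>, \<open>idem_swap\<close>, \<open>idem_absorb\<close>). The formula for \<open>x\<^sup>2\<close> therefore splits: on the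
  part where \<open>e = 1\<close> it says \<open>x\<^sup>2 + m x - 1 = m u h\<close>, and on the part where \<open>e = 0\<close> it says
  \<open>x\<^sup>2 + m - 1 = 0\<close>. So \<open>(x\<^sup>2 + m - 1) (x\<^sup>2 + m x - 1) = m u (x\<^sup>2 + m - 1) h\<close>, and \<open>x h = u h\<close> gives the quartic
  relation (\<open>quartic_congruence\<close>); multiplication by \<open>x - u\<close> kills the right-hand side.

  For minimality, if \<open>p(x) = c h\<close> holds in the algebra, then in every representation where \<open>h\<close> acts
  as zero each eigenvalue of \<open>x\<close> is a root of \<open>p\<close>. Over the algebraic closure of \<open>K\<close> it suffices to
  exhibit representations with enough different eigenvalues.

  \<^item> Let \<open>a\<close> be a root of \<open>a\<^sup>2 + m a - 1\<close>, let \<open>\<mu>\<^sup>2 = 1 - m\<close> and let \<open>1 + w + \<dots> + w\<^sup>d\<^sup>-\<^sup>1 = 0\<close>, which is possible for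
    \<open>d \<ge> 2\<close>. The module of functions on the strands, where \<open>g\<^sub>j\<close> exchanges the positions \<open>j\<close> and \<open>j + 1\<close>
    up to the factor \<open>\<mu>\<close> and multiplies the other values by \<open>a\<close>, where \<open>t\<^sub>j\<close> multiplies the value at
    \<open>j\<close> by \<open>w\<close> and \<open>h\<^sub>j\<close> is zero, satisfies all relations (\<open>permutation_acts_zero\<close>) and has the
    eigenvalues \<open>a\<close>, \<open>\<mu>\<close> and \<open>-\<mu>\<close>. Using both roots \<open>a\<close>, a polynomial \<open>p \<noteq> 0\<close> with \<open>p(x) = c h\<close> has four
    different roots.
  \<^item> If \<open>p(x) = 0\<close>, representations with \<open>h \<noteq> 0\<close> count too. When \<open>y\<^sub>k = \<zeta>\<^sup>k y\<^sub>0\<close> with \<open>\<zeta>\<^sup>d = 1\<close>, all \<open>t\<^sub>j\<close>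
    may act as the scalar \<open>\<zeta>\<close>, and what remains are the relations of the BMW algebra. They hold in
    the Lawrence-Krammer representation (\<open>arc_acts_zero\<close>), where \<open>h\<close> has rank one and its
    image is an eigenspace of \<open>x\<close> for the fifth eigenvalue \<open>u\<close>.
\<close>

hide_const (open) up_ring.coeff up_ring.monom Polynomials.degree

section \<open>Scalars in the free algebra\<close>

lemma poly_mapping_single_induct [case_names zero add_single]:
  assumes "P 0" and "\<And>a u c. P a \<Longrightarrow> P (a + Poly_Mapping.single u c)"
  shows "P a"
proof (induction a rule: update_induct)
  case const
  then show ?case by (rule assms(1))
next
  case (update a u c)
  have "Poly_Mapping.update u c a = a + Poly_Mapping.single u c"
    using update.hyps by (intro poly_mapping_eqI)
      (auto simp: lookup_update lookup_add lookup_single in_keys_iff when_def)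
  then show ?case using assms(2) update.IH by simp
qed

lemma const_0: "const 0 = 0"
  by (simp add: const_def)

lemma const_1: "const 1 = 1"
  by (simp add: const_def)

lemma const_add: "const (a + b) = const a + const b"
  by (simp add: const_def single_add)

lemma const_uminus: "const (- a) = - const a"
  by (simp add: const_def single_uminus)

lemma const_diff: "const (a - b) = const a - const b"
  by (simp add: const_def single_diff)

lemma const_mult: "const (a * b) = const a * const b"
  by (simp add: const_def mult_single)

lemma const_power: "const (a ^ k) = const a ^ k"
  by (induction k) (simp_all add: const_1 const_mult)

lemma const_central: "a * const c = const c * a"
  by (induction a rule: poly_mapping_single_induct)
    (simp_all add: const_def mult_single algebra_simps)

lemma const_left_commute: "a * (const c * z) = const c * (a * z)"
  by (metis const_central mult.assoc)

section \<open>The free algebra as a ring and its quotient\<close>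

lemma free_algebra_simps [simp]:
  "x \<otimes>\<^bsub>free_algebra n\<^esub> z = x * z" "x \<oplus>\<^bsub>free_algebra n\<^esub> z = x + z"
  "\<one>\<^bsub>free_algebra n\<^esub> = 1" "\<zero>\<^bsub>free_algebra n\<^esub> = 0"
  by (simp_all add: free_algebra_def)

abbreviation "carr n \<equiv> carrier (free_algebra n)"

lemma in_carr: "a \<in> carr n \<longleftrightarrow> (\<forall>w \<in> Poly_Mapping.keys a. set (letters w) \<subseteq> gens n)"
  by (simp add: free_algebra_def)

lemma carr_0 [simp]: "0 \<in> carr n"
  by (simp add: in_carr)

lemma carr_const [simp]: "const c \<in> carr n"
  by (simp add: in_carr const_def zero_word_def)

lemma carr_1 [simp]: "1 \<in> carr n"
  using carr_const[of 1] by (simp only: const_1)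

lemma carr_letter [simp]: "x \<in> gens n \<Longrightarrow> letter x \<in> carr n"
  by (simp add: in_carr letter_def)

lemma carr_add [simp]: "a \<in> carr n \<Longrightarrow> b \<in> carr n \<Longrightarrow> a + b \<in> carr n"
  using Poly_Mapping.keys_add[of a b] by (auto simp: in_carr)

lemma carr_mult [simp]: "a \<in> carr n \<Longrightarrow> b \<in> carr n \<Longrightarrow> a * b \<in> carr n"
  using Poly_Mapping.keys_mult[of a b] by (fastforce simp: in_carr plus_word_def)

lemma carr_uminus [simp]: "a \<in> carr n \<Longrightarrow> - a \<in> carr n"
  using carr_mult[OF carr_const[of "- 1"]] by (simp add: const_uminus const_1)

lemma carr_diff [simp]: "a \<in> carr n \<Longrightarrow> b \<in> carr n \<Longrightarrow> a - b \<in> carr n"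
  using carr_add[of a n "- b"] by simp

lemma carr_power [simp]: "a \<in> carr n \<Longrightarrow> a ^ k \<in> carr n"
  by (induction k) simp_all

lemma carr_sum: "(\<And>x. x \<in> A \<Longrightarrow> f x \<in> carr n) \<Longrightarrow> sum f A \<in> carr n"
  by (induction A rule: infinite_finite_induct) simp_all

lemma ring_free_algebra: "ring (free_algebra n)"
proof (rule ringI)
  show "abelian_group (free_algebra n)"
  proof (rule abelian_groupI)
    fix x assume "x \<in> carr n"
    then show "\<exists>z\<in>carr n. z \<oplus>\<^bsub>free_algebra n\<^esub> x = \<zero>\<^bsub>free_algebra n\<^esub>"
      by (intro bexI[of _ "- x"]) simp_all
  qed (simp_all add: algebra_simps)
  show "Group.monoid (free_algebra n)"
    by (rule monoidI) (simp_all add: mult.assoc)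
qed (simp_all add: algebra_simps)

interpretation FA: ring "free_algebra n" for n
  by (rule ring_free_algebra)

lemma free_algebra_uminus [simp]:
  assumes "a \<in> carr n"
  shows "\<ominus>\<^bsub>free_algebra n\<^esub> a = - a"
  by (rule FA.minus_equality) (use assms in simp_all)

lemma free_algebra_minus [simp]:
  assumes "b \<in> carr n"
  shows "a \<ominus>\<^bsub>free_algebra n\<^esub> b = a - b"
  using assms by (simp add: a_minus_def)

text \<open>
  The ideal generated by a set is the intersection of the ideals of the ring that contain it. It is
  what one expects only because all relators lie in the carrier.
\<close>
lemma relation_sides_in_carr:
  assumes "framization_rel d n y a b"
  shows "a \<in> carr n" "b \<in> carr n"
  using assms
  by (induction)
    (auto simp: Defs.e_def gens_def transpose_def intro!: carr_sum carr_mult carr_diff carr_add)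

lemma relators_carr: "{a - b | a b. framization_rel d n y a b} \<subseteq> carr n"
  using relation_sides_in_carr by auto

lemma ideal_framization_ideal: "ideal (framization_ideal d n y) (free_algebra n)"
  unfolding framization_ideal_def by (rule FA.genideal_ideal[OF relators_carr])

lemma relator_in_ideal:
  "framization_rel d n y a b \<Longrightarrow> a - b \<in> framization_ideal d n y"
  unfolding framization_ideal_def using FA.genideal_self[OF relators_carr[of d n y]] by blast

text \<open>
  The lemmas on \<open>cls\<close> rewrite a formula over the quotient ring as the class of one element of the
  free algebra, where type class algebra applies.
\<close>
lemma cls_ring_hom: "cls d n y \<in> ring_hom (free_algebra n) (framization d n y)"
  using ideal.rcos_ring_hom[OF ideal_framization_ideal[of d n y]]
  by (simp add: framization_def cls_def[abs_def])

interpretation F: ring "framization d n y" for d n y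
  unfolding framization_def by (rule ideal.quotient_is_ring[OF ideal_framization_ideal])

lemma cls_eq_iff:
  assumes "a \<in> carr n" "b \<in> carr n"
  shows "cls d n y a = cls d n y b \<longleftrightarrow> a - b \<in> framization_ideal d n y"
  using FA.quotient_eq_iff_same_a_r_cos[OF ideal_framization_ideal assms] assms
  by (simp add: cls_def)

lemma cls_add:
  assumes "a \<in> carr n" "b \<in> carr n"
  shows "cls d n y a \<oplus>\<^bsub>framization d n y\<^esub> cls d n y b = cls d n y (a + b)"
  using ring_hom_add[OF cls_ring_hom assms] by simp

lemma cls_mult:
  assumes "a \<in> carr n" "b \<in> carr n"
  shows "cls d n y a \<otimes>\<^bsub>framization d n y\<^esub> cls d n y b = cls d n y (a * b)"
  using ring_hom_mult[OF cls_ring_hom assms] by simp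

lemma cls_1: "\<one>\<^bsub>framization d n y\<^esub> = cls d n y 1"
  using ring_hom_one[OF cls_ring_hom, of d n y] by simp

lemma cls_closed: "a \<in> carr n \<Longrightarrow> cls d n y a \<in> carrier (framization d n y)"
  by (rule ring_hom_closed[OF cls_ring_hom])

lemma cls_0: "\<zero>\<^bsub>framization d n y\<^esub> = cls d n y 0"
  using cls_add[of 0 n 0 d y] cls_closed[of 0 n d y] by (simp add: F.add.r_cancel_one)

lemma cls_diff:
  assumes "a \<in> carr n" "b \<in> carr n"
  shows "cls d n y a \<ominus>\<^bsub>framization d n y\<^esub> cls d n y b = cls d n y (a - b)"
proof -
  have "\<ominus>\<^bsub>framization d n y\<^esub> cls d n y b = cls d n y (- b)"
    using assms by (intro F.minus_equality) (simp_all add: cls_closed cls_add cls_0)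
  then show ?thesis using assms by (simp add: a_minus_def cls_add)
qed

lemma cls_power:
  assumes "a \<in> carr n"
  shows "cls d n y a [^]\<^bsub>framization d n y\<^esub> k = cls d n y (a ^ k)"
  by (induction k) (simp_all add: cls_1 cls_mult assms power_commutes)

lemma cls_finsum:
  assumes "finite A" "\<And>x. x \<in> A \<Longrightarrow> f x \<in> carr n"
  shows "finsum (framization d n y) (\<lambda>x. cls d n y (f x)) A = cls d n y (sum f A)"
  using assms by (induction A) (auto simp: cls_0 cls_add cls_closed carr_sum)

lemma poly_at_cls:
  assumes "a \<in> carr n"
  shows "poly_at (framization d n y) (\<lambda>c. cls d n y (const c)) p (cls d n y a)
    = cls d n y (\<Sum>k\<le>degree p. const (coeff p k) * a ^ k)"
  unfolding poly_at_def using assms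
  by (simp add: cls_power cls_mult cls_finsum)

lemmas cls_hom = cls_add cls_diff cls_mult cls_power cls_0

section \<open>The ground field\<close>

lemma of_nat_K_eq_0_iff: "(of_nat d :: K) = 0 \<longleftrightarrow> d = 0"
proof -
  have "(of_nat d :: K) = Fract (of_nat d) 1"
    by (induction d) (simp_all add: Zero_fract_def One_fract_def)
  then show ?thesis by (simp add: Zero_fract_def eq_fract)
qed

lemma m_nonzero: "m\<^sub>K \<noteq> 0" and l_nonzero: "l\<^sub>K \<noteq> 0"
  by (simp_all add: m\<^sub>K_def l\<^sub>K_def Zero_fract_def eq_fract)

text \<open>
  In turn: \<open>\<mu> = 0\<close>, a double root of \<open>x\<^sup>2 + m x - 1\<close>, \<open>l\<^sup>-\<^sup>1\<close> being a root of \<open>x\<^sup>2 + m x - 1\<close>, and \<open>l\<^sup>-\<^sup>1\<close> being a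
  root of \<open>x\<^sup>2 + m - 1\<close> are the coincidences of eigenvalues that have to be excluded.
\<close>
lemma K_inequalities:
  shows "m\<^sub>K \<noteq> 1" and "m\<^sub>K\<^sup>2 + 4 \<noteq> 0"
    and "1 + m\<^sub>K * l\<^sub>K - l\<^sub>K\<^sup>2 \<noteq> 0" and "1 - l\<^sub>K\<^sup>2 + m\<^sub>K * l\<^sub>K\<^sup>2 \<noteq> 0"
proof -
  have four: "(4 :: K) = Fract 4 1"
    by (metis Fract_of_nat_eq of_nat_numeral)
  show "m\<^sub>K \<noteq> 1" "m\<^sub>K\<^sup>2 + 4 \<noteq> 0"
    "1 + m\<^sub>K * l\<^sub>K - l\<^sub>K\<^sup>2 \<noteq> 0" "1 - l\<^sub>K\<^sup>2 + m\<^sub>K * l\<^sub>K\<^sup>2 \<noteq> 0"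
    by (simp_all add: m\<^sub>K_def l\<^sub>K_def One_fract_def Zero_fract_def four eq_fract power2_eq_square numeral_poly one_pCons)
qed

section \<open>Congruences modulo an ideal and the idempotent of two commuting roots of unity\<close>

text \<open>
  A subring \<open>C\<close> of a type class ring with a two-sided ideal \<open>I\<close> of \<open>C\<close>. Calculating with representatives
  modulo \<open>I\<close> keeps the ring operations and the simplifier of the ambient type.
\<close>
locale ideal_congruence =
  fixes C I :: "'a::ring_1 set"
  assumes one: "1 \<in> C"
    and diff: "a \<in> C \<Longrightarrow> b \<in> C \<Longrightarrow> a - b \<in> C"
    and mult: "a \<in> C \<Longrightarrow> b \<in> C \<Longrightarrow> a * b \<in> C"
    and ideal_zero: "0 \<in> I"
    and ideal_diff: "a \<in> I \<Longrightarrow> b \<in> I \<Longrightarrow> a - b \<in> I"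
    and ideal_left: "a \<in> C \<Longrightarrow> b \<in> I \<Longrightarrow> a * b \<in> I"
    and ideal_right: "a \<in> I \<Longrightarrow> b \<in> C \<Longrightarrow> a * b \<in> I"
begin

definition cong (infix "\<approx>" 50) where "a \<approx> b \<longleftrightarrow> a - b \<in> I"

lemma ideal_uminus: "a \<in> I \<Longrightarrow> - a \<in> I"
  using ideal_diff[OF ideal_zero] by simp

lemma ideal_add: "a \<in> I \<Longrightarrow> b \<in> I \<Longrightarrow> a + b \<in> I"
  using ideal_diff[of a "- b"] ideal_uminus[of b] by simp

lemma zero: "0 \<in> C"
  using diff[OF one one] by simp

lemma add: "a \<in> C \<Longrightarrow> b \<in> C \<Longrightarrow> a + b \<in> C"
  using diff[of a "0 - b"] diff[OF zero, of b] by simp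

lemma power: "a \<in> C \<Longrightarrow> a ^ k \<in> C"
  by (induction k) (simp_all add: one mult)

lemma sum_closed: "(\<And>x. x \<in> A \<Longrightarrow> f x \<in> C) \<Longrightarrow> sum f A \<in> C"
  by (induction A rule: infinite_finite_induct) (simp_all add: zero add)

lemma cong_refl: "a \<approx> a"
  by (simp add: cong_def ideal_zero)

lemma cong_sym: "a \<approx> b \<Longrightarrow> b \<approx> a"
  unfolding cong_def using ideal_uminus[of "a - b"] by simp

lemma cong_trans [trans]: "a \<approx> b \<Longrightarrow> b \<approx> c \<Longrightarrow> a \<approx> c"
  unfolding cong_def using ideal_add[of "a - b" "b - c"] by simp

lemma cong_add: "a \<approx> b \<Longrightarrow> a' \<approx> b' \<Longrightarrow> a + a' \<approx> b + b'"
  unfolding cong_def using ideal_add[of "a - b" "a' - b'"] by (simp add: algebra_simps)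

lemma cong_diff: "a \<approx> b \<Longrightarrow> a' \<approx> b' \<Longrightarrow> a - a' \<approx> b - b'"
  unfolding cong_def using ideal_diff[of "a - b" "a' - b'"] by (simp add: algebra_simps)

lemma cong_left: "c \<in> C \<Longrightarrow> a \<approx> b \<Longrightarrow> c * a \<approx> c * b"
  unfolding cong_def using ideal_left[of c "a - b"] by (simp add: algebra_simps)

lemma cong_right: "c \<in> C \<Longrightarrow> a \<approx> b \<Longrightarrow> a * c \<approx> b * c"
  unfolding cong_def using ideal_right[of "a - b" c] by (simp add: algebra_simps)

lemma cong_sum: "(\<And>x. x \<in> A \<Longrightarrow> f x \<approx> f' x) \<Longrightarrow> sum f A \<approx> sum f' A"
  by (induction A rule: infinite_finite_induct) (simp_all add: cong_refl cong_add)

lemma cong_power_commute: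
  assumes "a \<in> C" "b \<in> C" "a' \<in> C" "a * b \<approx> b * a'"
  shows "a ^ k * b \<approx> b * a' ^ k"
proof (induction k)
  case 0
  show ?case by (simp add: cong_refl)
next
  case (Suc k)
  have "a ^ Suc k * b = a * (a ^ k * b)" by (simp add: mult.assoc)
  also have "\<dots> \<approx> a * (b * a' ^ k)" by (rule cong_left[OF assms(1) Suc])
  also have "a * (b * a' ^ k) = (a * b) * a' ^ k" by (simp add: mult.assoc)
  also have "\<dots> \<approx> (b * a') * a' ^ k" by (intro cong_right power assms)
  finally show ?case by (simp add: mult.assoc)
qed

end

text \<open>
  The situation of \<open>t\<^sub>i\<close> and \<open>t\<^sub>i\<^sub>+\<^sub>1\<close>, with \<open>c\<close> in the role of \<open>1/d\<close>. Modulo the ideal, \<open>S\<^sup>s T\<^sup>d\<^sup>-\<^sup>s\<close> is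
  \<open>(S T\<^sup>-\<^sup>1)\<^sup>s\<close>, and the average of these powers is the projection onto the part where \<open>S\<close> and \<open>T\<close> agree.
\<close>
locale commuting_roots_of_unity = ideal_congruence +
  fixes d :: nat and S T c :: 'a
  assumes carriers: "S \<in> C" "T \<in> C" "c \<in> C"
    and S_order: "S ^ d \<approx> 1" and T_order: "T ^ d \<approx> 1"
    and commute: "S * T \<approx> T * S"
    and c_central: "x * c = c * x"
    and c_inverse: "c * of_nat d = 1"
begin

definition idem where "idem = c * (\<Sum>s<d. S ^ s * T ^ (d - s))"

lemma c_left_commute: "x * (c * z) = c * (x * z)"
  by (metis c_central mult.assoc)

lemma idem_closed: "idem \<in> C"
  unfolding idem_def by (intro mult sum_closed power carriers)

lemma commute_power: "S ^ k * T \<approx> T * S ^ k"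
  by (rule cong_power_commute) (use carriers commute in auto)

lemma commute_powers: "S ^ j * T ^ k \<approx> T ^ k * S ^ j"
  using cong_power_commute[of T "S ^ j" T k] carriers power commute_power cong_sym by blast

lemma word_absorb:
  assumes "z \<in> C" "S * z \<approx> T * z"
  shows "S ^ s * T ^ k * z \<approx> T ^ (s + k) * z"
proof (induction s arbitrary: k)
  case 0
  show ?case by (simp add: cong_refl)
next
  case (Suc s)
  have "S ^ Suc s * T ^ k * z = S ^ s * ((S ^ 1 * T ^ k) * z)"
    by (simp add: mult.assoc power_Suc2 del: power_Suc)
  also have "\<dots> \<approx> S ^ s * ((T ^ k * S ^ 1) * z)"
    by (intro cong_left cong_right power carriers assms commute_powers)
  also have "S ^ s * ((T ^ k * S ^ 1) * z) = (S ^ s * T ^ k) * (S * z)"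
    by (simp add: mult.assoc)
  also have "\<dots> \<approx> (S ^ s * T ^ k) * (T * z)"
    by (intro cong_left mult power carriers assms)
  also have "(S ^ s * T ^ k) * (T * z) = S ^ s * T ^ Suc k * z"
    by (simp add: mult.assoc power_Suc2 del: power_Suc)
  also have "\<dots> \<approx> T ^ (s + Suc k) * z"
    by (rule Suc)
  finally show ?case by simp
qed

text \<open>
  Where \<open>S\<close> and \<open>T\<close> agree, every summand \<open>S\<^sup>s T\<^sup>d\<^sup>-\<^sup>s\<close> acts as \<open>T\<^sup>d = 1\<close>. This serves both for \<open>z = h\<close> and,
  by the next lemma, for the idempotent itself.
\<close>
lemma idem_absorb:
  assumes "z \<in> C" "S * z \<approx> T * z"
  shows "idem * z \<approx> z"
proof -
  have summand: "S ^ s * T ^ (d - s) * z \<approx> z" if "s < d" for s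
  proof -
    have "S ^ s * T ^ (d - s) * z \<approx> T ^ (s + (d - s)) * z"
      by (rule word_absorb[OF assms])
    also have "T ^ (s + (d - s)) * z = T ^ d * z" using that by simp
    also have "\<dots> \<approx> 1 * z" by (intro cong_right assms T_order)
    finally show ?thesis by simp
  qed
  have "idem * z = c * (\<Sum>s<d. S ^ s * T ^ (d - s) * z)"
    by (simp add: idem_def sum_distrib_right mult.assoc)
  also have "\<dots> \<approx> c * (\<Sum>s<d. z)"
    by (intro cong_left carriers cong_sum summand) simp
  also have "c * (\<Sum>s<d. z) = z"
    using c_inverse by (simp add: mult.assoc[symmetric])
  finally show ?thesis .
qed

text \<open>
  Both sides are the sum of \<open>S\<^sup>s T\<^sup>d\<^sup>+\<^sup>1\<^sup>-\<^sup>s\<close>, taken over \<open>1 \<le> s \<le> d\<close> on the left and over \<open>0 \<le> s < d\<close> on the right.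
  They differ in the terms \<open>S\<^sup>d T\<close> and \<open>T\<^sup>d\<^sup>+\<^sup>1\<close>, which are congruent.
\<close>
lemma S_idem: "S * idem \<approx> T * idem"
proof -
  let ?f = "\<lambda>s. S ^ s * T ^ (Suc d - s)"
  have "S * idem = c * (\<Sum>s<d. ?f (Suc s))"
    by (simp add: idem_def c_left_commute[of S] sum_distrib_left[of S] mult.assoc)
  also have "(\<Sum>s<d. ?f (Suc s)) = (\<Sum>s<d. ?f s) + (?f d - ?f 0)"
    using sum.lessThan_Suc_shift[of ?f d] by (simp add: algebra_simps)
  also have "c * \<dots> \<approx> c * ((\<Sum>s<d. T * (S ^ s * T ^ (d - s))) + 0)"
  proof (intro cong_left carriers cong_add cong_sum)
    fix s assume "s \<in> {..<d}"
    then have "?f s = S ^ s * T * T ^ (d - s)"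
      by (simp add: Suc_diff_le mult.assoc)
    also have "\<dots> \<approx> (T * S ^ s) * T ^ (d - s)"
      by (intro cong_right power carriers commute_power)
    finally show "?f s \<approx> T * (S ^ s * T ^ (d - s))" by (simp add: mult.assoc)
  next
    have "S ^ d * T - T * T ^ d \<approx> 1 * T - T * 1"
      by (intro cong_diff cong_left cong_right carriers S_order T_order)
    then show "?f d - ?f 0 \<approx> 0" by simp
  qed
  also have "c * ((\<Sum>s<d. T * (S ^ s * T ^ (d - s))) + 0) = T * idem"
    by (simp add: idem_def c_left_commute[of T] sum_distrib_left[of T])
  finally show ?thesis .
qed

lemma idem_idem: "idem * idem \<approx> idem"
  by (rule idem_absorb[OF idem_closed S_idem])

text \<open>
  Passing \<open>z\<close> exchanges \<open>S\<close> and \<open>T\<close>, which reverses the sum. As \<open>s\<close> runs over \<open>0 \<le> s < d\<close>, the reversed index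
  \<open>d - s\<close> runs over \<open>1 \<le> s \<le> d\<close>, so that \<open>S\<^sup>d\<close> replaces \<open>T\<^sup>d\<close>.
\<close>
lemma idem_swap:
  assumes "z \<in> C" "S * z \<approx> z * T" "T * z \<approx> z * S"
  shows "idem * z \<approx> z * idem"
proof -
  let ?f = "\<lambda>s. S ^ s * T ^ (d - s)"
  have word: "?f s * z \<approx> z * ?f (d - s)" if "s \<le> d" for s
  proof -
    have "?f s * z = S ^ s * (T ^ (d - s) * z)" by (simp add: mult.assoc)
    also have "\<dots> \<approx> S ^ s * (z * S ^ (d - s))"
      by (intro cong_left cong_power_commute power carriers assms)
    also have "S ^ s * (z * S ^ (d - s)) = (S ^ s * z) * S ^ (d - s)"
      by (simp add: mult.assoc)
    also have "\<dots> \<approx> (z * T ^ s) * S ^ (d - s)"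
      by (intro cong_right cong_power_commute power carriers assms)
    also have "(z * T ^ s) * S ^ (d - s) = z * (T ^ s * S ^ (d - s))"
      by (simp add: mult.assoc)
    also have "\<dots> \<approx> z * (S ^ (d - s) * T ^ s)"
      by (intro cong_left assms cong_sym[OF commute_powers])
    finally show ?thesis using that by simp
  qed
  have "(\<Sum>s<d. ?f (d - s)) = (\<Sum>s<d. ?f (Suc s))"
    by (subst sum.nat_diff_reindex[symmetric]) (simp add: Suc_diff_Suc)
  also have "\<dots> = (\<Sum>s<d. ?f s) + (?f d - ?f 0)"
    using sum.lessThan_Suc_shift[of ?f d] by (simp add: algebra_simps)
  also have "\<dots> \<approx> (\<Sum>s<d. ?f s) + (1 - 1)"
    using S_order T_order by (intro cong_add cong_refl cong_diff) simp_all
  finally have reverse: "(\<Sum>s<d. ?f (d - s)) \<approx> (\<Sum>s<d. ?f s)" by simp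
  have "idem * z = c * (\<Sum>s<d. ?f s * z)"
    by (simp add: idem_def sum_distrib_right mult.assoc)
  also have "\<dots> \<approx> c * (\<Sum>s<d. z * ?f (d - s))"
    by (intro cong_left carriers cong_sum word) simp
  also have "c * (\<Sum>s<d. z * ?f (d - s)) = (z * c) * (\<Sum>s<d. ?f (d - s))"
    by (simp add: sum_distrib_left[symmetric] c_central mult.assoc)
  also have "\<dots> \<approx> (z * c) * (\<Sum>s<d. ?f s)"
    by (intro cong_left mult carriers assms reverse)
  finally show ?thesis by (simp add: idem_def mult.assoc)
qed

end

section \<open>The quartic relation\<close>

context ideal_congruence
begin

context
  fixes g e h m u :: 'a
  assumes closed: "g \<in> C" "e \<in> C" "h \<in> C" "m \<in> C" "u \<in> C"
    and central: "\<And>x. x * m = m * x" "\<And>x. x * u = u * x"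
    and square: "g\<^sup>2 \<approx> 1 - m - m * e * (g - 1) + m * u * h"
    and gh: "g * h \<approx> u * h"
    and eg: "e * g \<approx> g * e"
    and ee: "e * e \<approx> e"
    and eh: "e * h \<approx> h"
begin

lemma scalar_left_commute: "x * (m * z) = m * (x * z)" "x * (u * z) = u * (x * z)"
  by (metis central mult.assoc)+

(* Pulling m to the left of u and both to the left of the generators, instance by instance,
   keeps the rewriting terminating. *)
lemmas pull_scalars =
  central(1)[of g] central(1)[of e] central(1)[of h] central(1)[of u]
  central(2)[of g] central(2)[of e] central(2)[of h]
  scalar_left_commute(1)[of g] scalar_left_commute(1)[of e] scalar_left_commute(1)[of h]
  scalar_left_commute(1)[of u]
  scalar_left_commute(2)[of g] scalar_left_commute(2)[of e] scalar_left_commute(2)[of h]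

lemmas scalar_normal_form = power2_eq_square algebra_simps pull_scalars

text \<open>
  This is \<open>e\<close> times the formula for \<open>g\<^sup>2\<close>. Here and in the next two lemmas the difference of the two
  sides is written as an explicit combination of relators with coefficients in the ring.
\<close>
lemma on_idempotent: "e * (g\<^sup>2 + m * g - 1) \<approx> m * u * h"
proof -
  have "e * (g\<^sup>2 - (1 - m - m * e * (g - 1) + m * u * h))
      - m * ((e * e - e) * (g - 1)) + m * u * (e * h - h) \<in> I"
    by (rule ideal_add[OF ideal_diff[OF ideal_left ideal_left[OF _ ideal_right]] ideal_left])
      (use square ee eh closed in \<open>simp_all add: cong_def diff mult one\<close>)
  then show ?thesis by (simp add: cong_def scalar_normal_form)
qed

text \<open>
  Multiplied by \<open>1 - e\<close>, the formula for \<open>g\<^sup>2\<close> says \<open>(1 - e) (g\<^sup>2 + m - 1) = 0\<close>; the idempotent is then moved to the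
  right, where the factor \<open>g\<^sup>2 + m g - 1\<close> of the quartic is waiting.
\<close>
lemma off_idempotent: "g\<^sup>2 + m - 1 \<approx> (g\<^sup>2 + m - 1) * e"
proof -
  have "(1 - e) * (g\<^sup>2 - (1 - m - m * e * (g - 1) + m * u * h))
      + m * ((e * e - e) * (g - 1)) - m * u * (e * h - h)
      + (g * (e * g - g * e) + (e * g - g * e) * g) \<in> I"
    by (rule ideal_add[OF ideal_diff[OF ideal_add[OF ideal_left ideal_left[OF _ ideal_right]]
            ideal_left] ideal_add[OF ideal_left ideal_right]])
      (use square ee eh eg closed in \<open>simp_all add: cong_def diff mult one\<close>)
  then show ?thesis by (simp add: cong_def scalar_normal_form)
qed

lemma quartic_congruence:
  "(g\<^sup>2 + m - 1) * (g\<^sup>2 + m * g - 1) \<approx> m * u * (m + u\<^sup>2 - 1) * h"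
proof -
  have "(g\<^sup>2 + m - 1) * (g\<^sup>2 + m * g - 1) \<approx> (g\<^sup>2 + m - 1) * e * (g\<^sup>2 + m * g - 1)"
    by (intro cong_right off_idempotent diff add mult power one closed)
  also have "(g\<^sup>2 + m - 1) * e * (g\<^sup>2 + m * g - 1)
      = (g\<^sup>2 + m - 1) * (e * (g\<^sup>2 + m * g - 1))"
    by (simp add: mult.assoc)
  also have "\<dots> \<approx> (g\<^sup>2 + m - 1) * (m * u * h)"
    by (intro cong_left on_idempotent diff add mult power one closed)
  also have "\<dots> \<approx> m * u * (m + u\<^sup>2 - 1) * h"
  proof -
    have "m * u * (g * (g * h - u * h) + u * (g * h - u * h)) \<in> I"
      by (rule ideal_left[OF _ ideal_add[OF ideal_left ideal_left]])
        (use gh closed in \<open>simp_all add: cong_def mult\<close>)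
    then show ?thesis by (simp add: cong_def scalar_normal_form)
  qed
  finally show ?thesis .
qed

end

end

lemma ideal_congruence_framization: "ideal_congruence (carr n) (framization_ideal d n y)"
proof -
  interpret ideal "framization_ideal d n y" "free_algebra n"
    by (rule ideal_framization_ideal)
  show ?thesis
  proof
    show "a - b \<in> framization_ideal d n y"
      if "a \<in> framization_ideal d n y" "b \<in> framization_ideal d n y" for a b
      using a_closed[OF that(1) a_inv_closed[OF that(2)]] Icarr[OF that(2)] by simp
    show "0 \<in> framization_ideal d n y"
      using additive_subgroup.zero_closed[OF is_additive_subgroup] by simp
    show "a * b \<in> framization_ideal d n y" if "a \<in> carr n" "b \<in> framization_ideal d n y" for a b
      using I_l_closed[OF that(2,1)] by simp
    show "a * b \<in> framization_ideal d n y" if "a \<in> framization_ideal d n y" "b \<in> carr n" for a b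
      using I_r_closed[OF that] by simp
  qed simp_all
qed

lemma const_of_nat: "const (of_nat k) = of_nat k"
  by (induction k) (simp_all add: const_0 const_1 const_add)

lemma quartic_relation:
  fixes d n i :: nat and y :: "nat \<Rightarrow> K"
  defines "M \<equiv> const m\<^sub>K" and "U \<equiv> const (inverse l\<^sub>K)"
  defines "x \<equiv> letter (G i)" and "h \<equiv> letter (H i)"
  assumes "1 \<le> d" "1 \<le> i" "i < n"
  shows "(x\<^sup>2 + M - 1) * (x\<^sup>2 + M * x - 1) - M * U * (M + U\<^sup>2 - 1) * h \<in> framization_ideal d n y"
    and "x * h - U * h \<in> framization_ideal d n y"
proof -
  interpret ideal_congruence "carr n" "framization_ideal d n y"
    by (rule ideal_congruence_framization)
  have rel: "cong a b" if "framization_rel d n y a b" for a b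
    using relator_in_ideal[OF that] by (simp add: cong_def)
  let ?S = "letter (T i)" and ?T = "letter (T (i + 1))"
  have gens: "x \<in> carr n" "h \<in> carr n" "?S \<in> carr n" "?T \<in> carr n"
    using assms by (auto simp: gens_def)
  interpret T: commuting_roots_of_unity "carr n" "framization_ideal d n y" d ?S ?T "const (1 / of_nat d)"
  proof
    show "cong (?S ^ d) 1" "cong (?T ^ d) 1" "cong (?S * ?T) (?T * ?S)"
      using assms by (auto intro!: rel framization_rel.intros)
    show "const (1 / of_nat d) * of_nat d = 1"
      using assms by (simp add: const_of_nat[symmetric] const_mult[symmetric] of_nat_K_eq_0_iff const_1)
  qed (use gens in \<open>simp_all add: const_central\<close>)
  have e: "T.idem = Defs.e d i"
    by (simp only: T.idem_def Defs.e_def)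
  have tg: "cong (?S * x) (x * ?T)" "cong (?T * x) (x * ?S)"
    unfolding x_def using assms rel[OF framization_rel.tg[of i n i]] rel[OF framization_rel.tg[of i n "i + 1"]]
    by simp_all
  show "x * h - U * h \<in> framization_ideal d n y"
    unfolding x_def h_def U_def using assms rel[OF framization_rel.gh] by (simp add: cong_def)
  then have gh: "cong (x * h) (U * h)" by (simp add: cong_def)
  have square: "cong (x\<^sup>2) (1 - M - M * T.idem * (x - 1) + M * U * h)"
    unfolding x_def h_def M_def U_def e using assms rel[OF framization_rel.g_square, of i]
    by (simp add: const_diff const_mult const_1)
  have eh: "cong (T.idem * h) h"
    unfolding h_def using assms gens by (intro T.idem_absorb rel framization_rel.th) simp_all
  have "cong ((x\<^sup>2 + M - 1) * (x\<^sup>2 + M * x - 1)) (M * U * (M + U\<^sup>2 - 1) * h)"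
    by (rule quartic_congruence[OF gens(1) T.idem_closed gens(2) _ _ _ _ square gh
          T.idem_swap[OF gens(1) tg] T.idem_idem eh]) (simp_all add: M_def U_def const_central)
  then show "(x\<^sup>2 + M - 1) * (x\<^sup>2 + M * x - 1) - M * U * (M + U\<^sup>2 - 1) * h \<in> framization_ideal d n y"
    by (simp add: cong_def)
qed

section \<open>Linear representations over the algebraic closure\<close>

type_synonym L = "K alg_closure"

text \<open>
  An assignment of linear operators to the letters makes the functions \<open>'x \<Rightarrow> L\<close> a module over the free
  algebra; \<open>act\<close> is that module structure.
\<close>
locale linear_letters =
  fixes \<rho> :: "gen \<Rightarrow> ('x \<Rightarrow> L) \<Rightarrow> ('x \<Rightarrow> L)"
  assumes letter_add: "\<rho> x (\<lambda>k. v k + w k) = (\<lambda>k. \<rho> x v k + \<rho> x w k)"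
    and letter_scale: "\<rho> x (\<lambda>k. c * v k) = (\<lambda>k. c * \<rho> x v k)"
begin

definition act_word :: "gen word \<Rightarrow> ('x \<Rightarrow> L) \<Rightarrow> ('x \<Rightarrow> L)"
  where "act_word u = foldr \<rho> (letters u)"

definition act :: "free_elem \<Rightarrow> ('x \<Rightarrow> L) \<Rightarrow> ('x \<Rightarrow> L)"
  where "act a v = (\<lambda>k. \<Sum>u\<in>Poly_Mapping.keys a. to_ac (Poly_Mapping.lookup a u) * act_word u v k)"

lemma act_word_zero: "act_word 0 v = v"
  by (simp add: act_word_def zero_word_def)

lemma act_word_plus: "act_word (u + u') v = act_word u (act_word u' v)"
  by (simp add: act_word_def plus_word_def)

lemma foldr_add: "foldr \<rho> xs (\<lambda>k. v k + w k) = (\<lambda>k. foldr \<rho> xs v k + foldr \<rho> xs w k)"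
  by (induction xs) (simp_all add: letter_add)

lemma foldr_scale: "foldr \<rho> xs (\<lambda>k. c * v k) = (\<lambda>k. c * foldr \<rho> xs v k)"
  by (induction xs) (simp_all add: letter_scale)

lemma act_superset:
  assumes "finite A" "Poly_Mapping.keys a \<subseteq> A"
  shows "act a v = (\<lambda>k. \<Sum>u\<in>A. to_ac (Poly_Mapping.lookup a u) * act_word u v k)"
  unfolding act_def using assms
  by (intro ext sum.mono_neutral_left) (auto simp: in_keys_iff)

lemma act_0: "act 0 v = (\<lambda>k. 0)"
  by (simp add: act_def)

lemma act_single: "act (Poly_Mapping.single u c) v = (\<lambda>k. to_ac c * act_word u v k)"
  by (subst act_superset[of "{u}"]) auto

lemma act_add: "act (a + b) v = (\<lambda>k. act a v k + act b v k)"
proof -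
  let ?A = "Poly_Mapping.keys a \<union> Poly_Mapping.keys b"
  have "act (a + b) v = (\<lambda>k. \<Sum>u\<in>?A. to_ac (Poly_Mapping.lookup (a + b) u) * act_word u v k)"
    using Poly_Mapping.keys_add[of a b] by (intro act_superset) auto
  then show ?thesis
    by (simp add: act_superset[of ?A a] act_superset[of ?A b] lookup_add
        distrib_right sum.distrib)
qed

lemma act_vector_add: "act a (\<lambda>k. v k + w k) = (\<lambda>k. act a v k + act a w k)"
  by (simp add: act_def act_word_def foldr_add distrib_left sum.distrib)

lemma act_vector_scale: "act a (\<lambda>k. c * v k) = (\<lambda>k. c * act a v k)"
  by (simp add: act_def act_word_def foldr_scale sum_distrib_left mult_ac)

lemma act_mult: "act (a * b) v = act a (act b v)"
proof (induction a rule: poly_mapping_single_induct)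
  case zero
  show ?case by (simp add: act_0)
next
  case (add_single a u c)
  have "act (Poly_Mapping.single u c * b) v = act (Poly_Mapping.single u c) (act b v)"
  proof (induction b rule: poly_mapping_single_induct)
    case zero
    show ?case using act_vector_scale[of _ 0] by (simp add: act_0)
  next
    case (add_single b u' c')
    then show ?case
      by (simp add: distrib_left act_add act_vector_add mult_single)
        (simp add: act_single act_word_plus[unfolded act_word_def] act_word_def foldr_scale mult_ac)
  qed
  then show ?case
    using add_single by (simp add: distrib_right act_add)
qed

lemma act_const: "act (const c) v = (\<lambda>k. to_ac c * v k)"
  by (simp add: const_def act_single act_word_zero)

lemma act_1: "act 1 v = v"
  using act_const[of 1] by (simp add: const_1)

lemma act_letter: "act (letter x) v = \<rho> x v"
  by (simp add: letter_def act_single act_word_def)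

lemma act_uminus: "act (- a) v = (\<lambda>k. - act a v k)"
  using act_add[of a "- a" v] by (simp add: act_0 fun_eq_iff eq_neg_iff_add_eq_0 add.commute)

lemma act_diff: "act (a - b) v = (\<lambda>k. act a v k - act b v k)"
  using act_add[of a "- b"] by (simp add: act_uminus)

lemma act_sum: "act (\<Sum>x\<in>A. f x) v = (\<lambda>k. \<Sum>x\<in>A. act (f x) v k)"
  by (induction A rule: infinite_finite_induct) (simp_all add: act_0 act_add)

lemma act_eigenvector:
  assumes "\<rho> x v = (\<lambda>k. \<theta> * v k)"
  shows "act (\<Sum>j\<le>N. const (coeff p j) * letter x ^ j) v
    = (\<lambda>k. (\<Sum>j\<le>N. to_ac (coeff p j) * \<theta> ^ j) * v k)"
proof -
  have "act (letter x ^ j) v = (\<lambda>k. \<theta> ^ j * v k)" for j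
  proof (induction j)
    case (Suc j)
    then show ?case
      by (simp add: act_mult act_letter letter_scale assms mult.assoc mult.left_commute)
  qed (simp add: act_1)
  then show ?thesis
    by (simp add: act_sum act_mult act_const sum_distrib_right mult.assoc)
qed

lemma ideal_annihilator:
  "ideal {a \<in> carr n. \<forall>v. act a v = (\<lambda>k. 0)} (free_algebra n)"
proof (rule idealI[OF ring_free_algebra])
  have "act a (\<lambda>k. 0) = (\<lambda>k. 0)" for a
    using act_vector_scale[of a 0] by simp
  note [simp] = this act_add act_mult act_uminus act_0
  show "subgroup {a \<in> carr n. \<forall>v. act a v = (\<lambda>k. 0)} (add_monoid (free_algebra n))"
    by (rule FA.add.subgroupI) (auto simp: a_inv_def[symmetric])
  fix a x
  assume "a \<in> {a \<in> carr n. \<forall>v. act a v = (\<lambda>k. 0)}" "x \<in> carr n"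
  then show "x \<otimes>\<^bsub>free_algebra n\<^esub> a \<in> {a \<in> carr n. \<forall>v. act a v = (\<lambda>k. 0)}"
    "a \<otimes>\<^bsub>free_algebra n\<^esub> x \<in> {a \<in> carr n. \<forall>v. act a v = (\<lambda>k. 0)}"
    by simp_all
qed

text \<open>
  A module over the free algebra in which the defining relations hold is a module over the
  framization: the annihilator is an ideal containing the relators.
\<close>
lemma framization_ideal_acts_zero:
  assumes "\<And>a b v. framization_rel d n y a b \<Longrightarrow> act a v = act b v"
    and "a \<in> framization_ideal d n y"
  shows "act a v = (\<lambda>k. 0)"
proof -
  have "framization_ideal d n y \<subseteq> {a \<in> carr n. \<forall>v. act a v = (\<lambda>k. 0)}"
    unfolding framization_ideal_def
    by (rule FA.genideal_minimal[OF ideal_annihilator])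
      (use assms(1) relation_sides_in_carr in \<open>auto simp: act_diff\<close>)
  then show ?thesis using assms(2) by auto
qed

end

lemma of_nat_L_eq_0_iff: "(of_nat d :: L) = 0 \<longleftrightarrow> d = 0"
  by (metis of_nat_K_eq_0_iff to_ac_eq_0_iff to_ac_of_nat)

text \<open>
  Representations with a basis of common eigenvectors of all \<open>t\<^sub>j\<close>; \<open>\<tau> j k\<close> is the eigenvalue of \<open>t\<^sub>j\<close> at
  \<open>k\<close>. There \<open>e\<^sub>i\<close> is diagonal too, with values \<open>1\<close> and \<open>0\<close> in the two cases below.
\<close>
locale framed_letters = linear_letters \<rho>
  for \<rho> :: "gen \<Rightarrow> ('x \<Rightarrow> L) \<Rightarrow> ('x \<Rightarrow> L)" +
  fixes \<tau> :: "nat \<Rightarrow> 'x \<Rightarrow> L" and d :: nat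
  assumes framing: "\<rho> (T j) v = (\<lambda>k. \<tau> j k * v k)"
    and framing_order: "\<tau> j k ^ d = 1"
begin

lemma act_framing_power: "act (letter (T j) ^ s) v = (\<lambda>k. \<tau> j k ^ s * v k)"
  by (induction s) (simp_all add: act_1 act_mult act_letter framing mult.assoc)

lemma act_e: "act (Defs.e d i) v
    = (\<lambda>k. to_ac (1 / of_nat d) * (\<Sum>s<d. \<tau> i k ^ s * \<tau> (i + 1) k ^ (d - s)) * v k)"
  by (simp add: Defs.e_def act_mult act_const act_sum act_framing_power sum_distrib_left
      sum_distrib_right mult.assoc)

lemma act_e_equal:
  assumes "d \<ge> 1" "\<tau> i k = \<tau> (i + 1) k"
  shows "act (Defs.e d i) v k = v k"
proof -
  have "(\<Sum>s<d. \<tau> i k ^ s * \<tau> (i + 1) k ^ (d - s)) = (\<Sum>s<d. 1)"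
    using assms framing_order by (intro sum.cong) (simp_all add: power_add[symmetric])
  then show ?thesis
    using assms by (simp add: act_e of_nat_L_eq_0_iff)
qed

lemma act_e_geometric:
  assumes "(\<Sum>s<d. w ^ s) = 0" "{\<tau> i k, \<tau> (i + 1) k} = {1, w}"
  shows "act (Defs.e d i) v k = 0"
proof -
  have "(\<Sum>s<d. w ^ (d - s)) = w * (\<Sum>s<d. w ^ (d - Suc s))"
    by (simp add: sum_distrib_left power_Suc[symmetric] Suc_diff_Suc del: power_Suc)
  also have "\<dots> = 0"
    using assms(1) by (simp add: sum.nat_diff_reindex)
  finally show ?thesis
    using assms by (auto simp: act_e doubleton_eq_iff)
qed

end

section \<open>Permutation representations, in which the tangles h vanish\<close>

text \<open>
  One strand carries the label \<open>w\<close>, and the argument of the function is its position. As the indices of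
  the generators start at \<open>1\<close>, the position \<open>0\<close> stands for the absence of a labelled strand and spans
  a one-dimensional summand on which all \<open>g\<^sub>j\<close> act by \<open>a\<close>.
\<close>
definition permutation_gen :: "L \<Rightarrow> L \<Rightarrow> L \<Rightarrow> gen \<Rightarrow> (nat \<Rightarrow> L) \<Rightarrow> (nat \<Rightarrow> L)"
  where "permutation_gen a \<mu> w x v = (case x of
      G j \<Rightarrow> (\<lambda>k. if k = j then \<mu> * v (j + 1) else if k = j + 1 then \<mu> * v j else a * v k)
    | H j \<Rightarrow> (\<lambda>k. 0)
    | T j \<Rightarrow> (\<lambda>k. (if k = j then w else 1) * v k))"

text \<open>
  At the positions \<open>i\<close> and \<open>i + 1\<close> the labels of the two strands differ, so \<open>e\<^sub>i = 0\<close> and \<open>g\<^sub>i\<^sup>2 = \<mu>\<^sup>2 = 1 - m\<close>. At all other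
  positions the labels agree, so \<open>e\<^sub>i = 1\<close> and \<open>a\<^sup>2 = 1 - m a\<close> is needed.
\<close>
lemma permutation_acts_zero:
  fixes a \<mu> w :: L
  assumes "d \<ge> 1" and root: "a\<^sup>2 + to_ac m\<^sub>K * a - 1 = 0" and mu: "\<mu>\<^sup>2 = 1 - to_ac m\<^sub>K"
    and w: "(\<Sum>s<d. w ^ s) = 0"
    and elem: "b \<in> framization_ideal d n y"
  shows "linear_letters.act (permutation_gen a \<mu> w) b v = (\<lambda>k. 0)"
proof -
  have wd: "w ^ d = 1"
    using w power_diff_1_eq[of w d] by simp
  interpret framed_letters "permutation_gen a \<mu> w" "\<lambda>j k. if k = j then w else 1" d
    by unfold_locales
      (auto simp: permutation_gen_def wd algebra_simps split: gen.splits)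
  have gen [simp]: "permutation_gen a \<mu> w (G j) v
        = (\<lambda>k. if k = j then \<mu> * v (j + 1) else if k = j + 1 then \<mu> * v j else a * v k)"
      "permutation_gen a \<mu> w (H j) v = (\<lambda>k. 0)"
      "permutation_gen a \<mu> w (T j) v = (\<lambda>k. (if k = j then w else 1) * v k)" for j v
    by (simp_all add: permutation_gen_def)
  have aa: "a * (a * z) = z - to_ac m\<^sub>K * (a * z)" for z
  proof -
    have "a * (a * z) - (z - to_ac m\<^sub>K * (a * z)) = (a\<^sup>2 + to_ac m\<^sub>K * a - 1) * z"
      by (simp add: algebra_simps power2_eq_square)
    then show ?thesis by (simp add: root)
  qed
  have mm: "to_ac m\<^sub>K + \<mu> * \<mu> = 1"
    using mu by (simp add: power2_eq_square)
  have "act r v = act r' v" if "framization_rel d n y r r'" for r r' v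
    using that
  proof cases
    case (g_square i)
    have "act (Defs.e d i) z k = (if k = i \<or> k = i + 1 then 0 else z k)" for z k
      using act_e_geometric[where v = z, OF w, where i = i and k = k]
        act_e_equal[where v = z, OF \<open>d \<ge> 1\<close>, where i = i and k = k]
      by (auto simp: insert_commute)
    then show ?thesis unfolding g_square
      by (intro ext) (simp add: power2_eq_square act_mult act_diff act_add act_const act_letter
          act_1, simp add: algebra_simps aa mm)
  next
    case (far_comm i j)
    then show ?thesis
      by (intro ext) (auto simp: act_mult act_letter)
  next
    case (tg i j)
    then show ?thesis
      by (intro ext) (auto simp: act_mult act_letter transpose_def)
  qed (simp_all add: act_mult act_const act_letter act_framing_power act_1 wd fun_eq_iff)
  then show ?thesis
    using framization_ideal_acts_zero elem by blast
qed

section \<open>Lawrence-Krammer representations, in which the tangles h have rank one\<close>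

text \<open>
  A rescaled Lawrence-Krammer representation, acting on coefficient functions: \<open>f (i, j)\<close> with \<open>i < j\<close>
  belongs to the arc that joins the points \<open>i\<close> and \<open>j\<close>, while every strand outside the arc contributes
  the eigenvalue \<open>a\<close> of a one-dimensional Hecke algebra representation. In the parameters \<open>q\<close>, \<open>t\<close> of Krammer,
  \<open>q = a\<^sup>-\<^sup>2\<close> and \<open>t = a\<^sup>3 u\<close>, the generator is multiplied by \<open>a\<close>, and the basis vector of \<open>(i, j)\<close> by \<open>q\<^sup>i\<close>; the
  last step removes all powers that depend on the distance of the points.
  The inverse \<open>b\<close> of \<open>a\<close> is a separate parameter, so that all coefficients are polynomials. Pairs with
  \<open>i \<ge> j\<close> carry no information; the scalar \<open>a\<close> there is compatible with all relations.
\<close>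
definition arc_gen :: "L \<Rightarrow> L \<Rightarrow> L \<Rightarrow> nat \<Rightarrow> (nat \<times> nat \<Rightarrow> L) \<Rightarrow> (nat \<times> nat \<Rightarrow> L)"
  where "arc_gen a b u k f = (\<lambda>(i, j). let m = b - a; f0 = f (k, k + 1) in
    if i \<ge> j then a * f (i, j)
    else if i = k \<and> j = k + 1 then u * f0
    else if j = k then b * f (i, k + 1) - m * f (i, k)
    else if j = k + 1 then a * f (i, k) + u * a * m * f0
    else if i = k then a * f (k + 1, j) + u * a * m * f0
    else if i = k + 1 then b * f (k, j) - m * f (k + 1, j)
    else if i < k \<and> k + 1 < j then a * f (i, j) + u * a\<^sup>2 * m\<^sup>2 * f0
    else a * f (i, j))"

text \<open>
  The operator \<open>(m u)\<^sup>-\<^sup>1 (g\<^sup>2 + m g - 1)\<close> has rank one: it sends \<open>f\<close> to the multiple \<open>f (k, k + 1)\<close> of this function,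
  which is thus what \<open>h\<^sub>k\<close> has to produce. The parameter \<open>y\<close> is the value of a closed loop.
\<close>
definition arc_coeff :: "L \<Rightarrow> L \<Rightarrow> L \<Rightarrow> L \<Rightarrow> nat \<Rightarrow> nat \<times> nat \<Rightarrow> L"
  where "arc_coeff a b u y k = (\<lambda>(i, j). let m = b - a in
    if i \<ge> j then 0
    else if i = k \<and> j = k + 1 then y
    else if j = k then 1
    else if j = k + 1 then a * (u + m)
    else if i = k then a * (u + m)
    else if i = k + 1 then 1
    else if i < k \<and> k + 1 < j then a * m * (a * u + 1)
    else 0)"

lemma arc_gen_simps:
  fixes a b u
  defines "m \<equiv> b - a"
  shows
    "i \<ge> j \<Longrightarrow> arc_gen a b u k f (i, j) = a * f (i, j)"
    "arc_gen a b u k f (k, Suc k) = u * f (k, Suc k)"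
    "i < k \<Longrightarrow> arc_gen a b u k f (i, k) = b * f (i, Suc k) - m * f (i, k)"
    "i < k \<Longrightarrow> arc_gen a b u k f (i, Suc k) = a * f (i, k) + u * a * m * f (k, Suc k)"
    "Suc k < j \<Longrightarrow> arc_gen a b u k f (k, j) = a * f (Suc k, j) + u * a * m * f (k, Suc k)"
    "Suc k < j \<Longrightarrow> arc_gen a b u k f (Suc k, j) = b * f (k, j) - m * f (Suc k, j)"
    "i < k \<Longrightarrow> Suc k < j \<Longrightarrow> arc_gen a b u k f (i, j) = a * f (i, j) + u * a\<^sup>2 * m\<^sup>2 * f (k, Suc k)"
    "j < k \<Longrightarrow> arc_gen a b u k f (i, j) = a * f (i, j)"
    "Suc k < i \<Longrightarrow> arc_gen a b u k f (i, j) = a * f (i, j)"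
  by (auto simp: arc_gen_def m_def Let_def)

lemma arc_coeff_simps:
  fixes a b u
  defines "m \<equiv> b - a"
  shows
    "i \<ge> j \<Longrightarrow> arc_coeff a b u y k (i, j) = 0"
    "arc_coeff a b u y k (k, Suc k) = y"
    "i < k \<Longrightarrow> arc_coeff a b u y k (i, k) = 1"
    "i < k \<Longrightarrow> arc_coeff a b u y k (i, Suc k) = a * (u + m)"
    "Suc k < j \<Longrightarrow> arc_coeff a b u y k (k, j) = a * (u + m)"
    "Suc k < j \<Longrightarrow> arc_coeff a b u y k (Suc k, j) = 1"
    "i < k \<Longrightarrow> Suc k < j \<Longrightarrow> arc_coeff a b u y k (i, j) = a * m * (a * u + 1)"
    "j < k \<Longrightarrow> arc_coeff a b u y k (i, j) = 0"
    "Suc k < i \<Longrightarrow> arc_coeff a b u y k (i, j) = 0"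
  by (auto simp: arc_coeff_def m_def Let_def)

text \<open>
  The nine positions of an arc relative to the points \<open>k\<close> and \<open>k + 1\<close>, one for each clause of
  \<open>arc_gen_simps\<close>.
\<close>
lemma strand_cases:
  fixes i j k :: nat
  obtains "i \<ge> j" | "i = k" "j = Suc k" | "i < k" "j = k" | "i < k" "j = Suc k"
    | "i = k" "Suc k < j" | "i = Suc k" "Suc k < j" | "i < k" "Suc k < j" | "i < j" "j < k" | "Suc k < i" "i < j"
  by linarith

text \<open>
  These equations and those of \<open>loop_rewrite\<close> are oriented such that, on the normal forms produced by
  \<open>algebra_simps\<close>, the simplifier decides the polynomial identities between the parameters below.
\<close>
lemma inverse_rewrite:
  fixes a b :: "'a::comm_ring_1"
  assumes "a * b = 1"
  shows "a * b = 1" "a * (b * z) = z"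
  using assms by (simp_all add: mult.assoc[symmetric])

lemma loop_rewrite:
  fixes a b u y :: "'a::comm_ring_1"
  assumes ab: "a * b = 1" and "(b - a) * u * y = (b - a) * u + u\<^sup>2 - 1"
  shows "b * (u * y) = a * (u * y) + b * u - a * u + u * u - 1"
    and "a * (a * (u * y)) = u * y - u + a * (a * u) - a * (u * u) + a"
    and "a * (a * (u * (y * z))) = (u * y - u + a * (a * u) - a * (u * u) + a) * z"
    and "b * (u * (y * z)) = (a * (u * y) + b * u - a * u + u * u - 1) * z"
proof -
  show *: "b * (u * y) = a * (u * y) + b * u - a * u + u * u - 1"
    using assms by (simp add: algebra_simps power2_eq_square)
  have "a * (b * (u * y)) = a * (a * (u * y) + b * u - a * u + u * u - 1)"
    by (simp only: *)
  then show **: "a * (a * (u * y)) = u * y - u + a * (a * u) - a * (u * u) + a"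
    by (simp add: algebra_simps inverse_rewrite[OF ab])
  show "a * (a * (u * (y * z))) = (u * y - u + a * (a * u) - a * (u * u) + a) * z"
    by (simp add: mult.assoc flip: **)
  show "b * (u * (y * z)) = (a * (u * y) + b * u - a * u + u * u - 1) * z"
    by (simp add: mult.assoc flip: *)
qed

lemma arc_gen_square:
  fixes a b u :: L
  defines "m \<equiv> b - a"
  assumes ab: "a * b = 1" and loop: "m * u * y = m * u + u\<^sup>2 - 1"
  shows "arc_gen a b u k (arc_gen a b u k f) (i, j)
    = f (i, j) - m * arc_gen a b u k f (i, j) + m * u * (arc_coeff a b u y k (i, j) * f (k, Suc k))"
  unfolding m_def
  by (cases rule: strand_cases[where i = i and j = j and k = k];
      simp add: arc_gen_simps arc_coeff_simps;
      simp add: algebra_simps power2_eq_square inverse_rewrite[OF ab] loop_rewrite[OF ab loop[unfolded m_def]])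

lemma arc_gen_coeff:
  fixes a b u :: L
  defines "m \<equiv> b - a"
  assumes ab: "a * b = 1" and loop: "m * u * y = m * u + u\<^sup>2 - 1"
  shows "arc_gen a b u k (arc_coeff a b u y k) (i, j) = u * arc_coeff a b u y k (i, j)"
  unfolding m_def
  by (cases rule: strand_cases[where i = i and j = j and k = k];
      simp add: arc_gen_simps arc_coeff_simps;
      simp add: algebra_simps power2_eq_square inverse_rewrite[OF ab] loop_rewrite[OF ab loop[unfolded m_def]])

text \<open>
  Splitting at \<open>k\<close> and at \<open>k + 1\<close> locates both ends of the arc relative to \<open>k\<close>, \<open>k + 1\<close>, \<open>k + 2\<close>; most of the \<open>81\<close>
  combinations are contradictory.
\<close>
lemma arc_gen_braid:
  fixes a b u :: L
  assumes "a * b = 1"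
  shows "arc_gen a b u k (arc_gen a b u (Suc k) (arc_gen a b u k f)) (i, j)
    = arc_gen a b u (Suc k) (arc_gen a b u k (arc_gen a b u (Suc k) f)) (i, j)"
  by (cases rule: strand_cases[where i = i and j = j and k = k];
      cases rule: strand_cases[where i = i and j = j and k = "Suc k"];
      simp add: arc_gen_simps;
      simp add: algebra_simps power2_eq_square inverse_rewrite[OF assms])

lemma arc_gen_commute:
  fixes a b u :: L
  assumes "Suc k < k'"
  shows "arc_gen a b u k (arc_gen a b u k' f) (i, j) = arc_gen a b u k' (arc_gen a b u k f) (i, j)"
  using assms
  by (cases rule: strand_cases[where i = i and j = j and k = k];
      cases rule: strand_cases[where i = i and j = j and k = k'];
      simp add: arc_gen_simps; simp add: algebra_simps)

definition arc_rep_gen :: "L \<Rightarrow> L \<Rightarrow> L \<Rightarrow> L \<Rightarrow> L \<Rightarrow> gen \<Rightarrow> (nat \<times> nat \<Rightarrow> L) \<Rightarrow> (nat \<times> nat \<Rightarrow> L)"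
  where "arc_rep_gen a b u y z x f = (case x of
      G k \<Rightarrow> arc_gen a b u k f
    | H k \<Rightarrow> (\<lambda>x. arc_coeff a b u y k x * f (k, Suc k))
    | T k \<Rightarrow> (\<lambda>x. z * f x))"

lemma arc_gen_add: "arc_gen a b u k (\<lambda>x. f x + f' x) = (\<lambda>x. arc_gen a b u k f x + arc_gen a b u k f' x)"
  by (auto simp: arc_gen_def Let_def algebra_simps)

lemma arc_gen_scale: "arc_gen a b u k (\<lambda>x. c * f x) = (\<lambda>x. c * arc_gen a b u k f x)"
  by (auto simp: arc_gen_def Let_def algebra_simps)

text \<open>
  The last two equations are the definition of \<open>y\<^sub>K\<close>, cleared of denominators.
\<close>
lemma arc_parameters:
  fixes a :: L
  assumes root: "a\<^sup>2 + to_ac m\<^sub>K * a - 1 = 0"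
  defines "b \<equiv> a + to_ac m\<^sub>K" and "u \<equiv> to_ac (inverse l\<^sub>K)"
  shows "a * b = 1"
    and "(b - a) * to_ac y\<^sub>K = b - a + u - to_ac l\<^sub>K"
    and "(b - a) * u * to_ac y\<^sub>K = (b - a) * u + u\<^sup>2 - 1"
proof -
  show "a * b = 1" using root by (simp add: b_def algebra_simps power2_eq_square)
  have m: "to_ac m\<^sub>K = b - a" by (simp add: b_def)
  have "b - a \<noteq> 0" using m m_nonzero by (metis to_ac_eq_0_iff)
  then show y: "(b - a) * to_ac y\<^sub>K = b - a + u - to_ac l\<^sub>K"
    by (simp add: y\<^sub>K_def m u_def field_simps)
  have lu: "to_ac l\<^sub>K * u = 1" using l_nonzero by (simp add: u_def)
  have "(b - a) * u * to_ac y\<^sub>K = u * ((b - a) * to_ac y\<^sub>K)" by simp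
  also have "\<dots> = u * (b - a) + u * u - to_ac l\<^sub>K * u"
    by (simp only: y, simp add: algebra_simps)
  finally show "(b - a) * u * to_ac y\<^sub>K = (b - a) * u + u\<^sup>2 - 1"
    by (simp add: lu power2_eq_square)
qed

text \<open>
  As all \<open>t\<^sub>j\<close> act by the scalar \<open>z\<close>, \<open>e\<^sub>i\<close> acts as the identity, and what is left to prove are the relations of
  the BMW algebra. The tangles \<open>h\<^sub>i\<close> have rank one, so each relation that contains \<open>h\<^sub>i\<close> twice is an equation
  between scalars; for \<open>h\<^sub>i g\<^sub>i\<^sub>\<plusminus>\<^sub>1 h\<^sub>i = l h\<^sub>i\<close> it is \<open>b a (u + m) - m y = l\<close>.
\<close>
lemma arc_acts_zero:
  fixes a b u z :: L and y :: "nat \<Rightarrow> K"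
  assumes "d \<ge> 1" and root: "a\<^sup>2 + to_ac m\<^sub>K * a - 1 = 0"
    and z: "z ^ d = 1" and y: "\<And>k. k < d \<Longrightarrow> to_ac (y k) = z ^ k * to_ac y\<^sub>K"
    and elem: "r \<in> framization_ideal d n y"
  defines "b \<equiv> a + to_ac m\<^sub>K" and "u \<equiv> to_ac (inverse l\<^sub>K)"
  shows "linear_letters.act (arc_rep_gen a b u (to_ac y\<^sub>K) z) r v = (\<lambda>x. 0)"
proof -
  define Y where "Y = to_ac y\<^sub>K"
  have m: "to_ac m\<^sub>K = b - a" by (simp add: b_def)
  have u: "inverse (to_ac l\<^sub>K) = u" by (simp add: u_def)
  note ab = arc_parameters(1)[OF root, folded b_def]
    and Y = arc_parameters(2)[OF root, folded b_def u_def Y_def]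
    and loop = arc_parameters(3)[OF root, folded b_def u_def Y_def]
  interpret framed_letters "arc_rep_gen a b u Y z" "\<lambda>j x. z" d
    by unfold_locales
      (auto simp: arc_rep_gen_def z algebra_simps arc_gen_add arc_gen_scale split: gen.splits)
  have gen [simp]: "arc_rep_gen a b u Y z (G k) f = arc_gen a b u k f"
      "arc_rep_gen a b u Y z (H k) f = (\<lambda>x. arc_coeff a b u Y k x * f (k, Suc k))"
      "arc_rep_gen a b u Y z (T k) f = (\<lambda>x. z * f x)" for k f
    by (simp_all add: arc_rep_gen_def)
  have scale: "arc_gen a b u k (\<lambda>x. f x * c) = (\<lambda>x. arc_gen a b u k f x * c)" for k c f
    using arc_gen_scale[of a b u k c f] by (simp add: mult.commute)
  have scale': "arc_gen a b u k (\<lambda>x. c * f x) x = c * arc_gen a b u k f x" for k c f x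
    by (simp add: arc_gen_scale)
  have coeff: "arc_gen a b u k (arc_coeff a b u Y k) x = u * arc_coeff a b u Y k x" for k x
    by (cases x) (simp add: arc_gen_coeff[OF ab loop])
  have hgh: "b * (a * (u + (b - a))) - (b - a) * Y = to_ac l\<^sub>K"
    by (simp add: Y mult.assoc[symmetric] mult.commute[of b a] ab)
  have "act r v = act r' v" if "framization_rel d n y r r'" for r r' v
    using that
  proof cases
    case (braid i)
    then show ?thesis
      by (auto simp: fun_eq_iff act_mult act_letter arc_gen_braid[OF ab])
  next
    case (far_comm i j)
    then consider "Suc i < j" | "Suc j < i" by linarith
    then show ?thesis
      using far_comm arc_gen_commute[of i j a b u v] arc_gen_commute[of j i a b u v]
      by cases (auto simp: fun_eq_iff act_mult act_letter)
  next
    case (gh i)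
    then show ?thesis
      by (simp add: fun_eq_iff act_mult act_letter act_const scale coeff u)
  next
    case (hgh_right i)
    then show ?thesis
      by (simp add: fun_eq_iff act_mult act_letter act_const scale arc_gen_simps arc_coeff_simps hgh)
  next
    case (hgh_left i)
    then show ?thesis
      by (simp add: fun_eq_iff act_mult act_letter act_const scale arc_gen_simps arc_coeff_simps hgh)
  next
    case (hth i k)
    then show ?thesis
      by (simp add: fun_eq_iff act_mult act_letter act_const act_framing_power arc_coeff_simps y Y_def[symmetric])
  next
    case (g_square i)
    have "act (Defs.e d i) f = f" for f
      using act_e_equal[OF \<open>d \<ge> 1\<close>] by (simp add: fun_eq_iff)
    then show ?thesis unfolding g_square using arc_gen_square[OF ab loop, of i v]
      by (auto simp add: fun_eq_iff power2_eq_square act_mult act_diff act_add act_const act_letter act_1 m u algebra_simps)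
  qed (auto simp: fun_eq_iff act_mult act_letter act_framing_power act_1 z scale' mult.left_commute)
  then show ?thesis
    using framization_ideal_acts_zero elem unfolding Y_def by blast
qed

section \<open>Eigenvalues of the braid generator\<close>

lemma ex_sqrt: "\<exists>\<mu> :: L. \<mu>\<^sup>2 = c"
  using alg_closed[of 2 "\<lambda>k. if k = 0 then - c else if k = 1 then 0 else 1"]
  by (auto simp: numeral_2_eq_2)

lemma ex_quadratic_root: "\<exists>a :: L. a\<^sup>2 + c * a - 1 = 0"
  using alg_closed[of 2 "\<lambda>k. if k = 0 then - 1 else if k = 1 then c else 1"]
  by (auto simp: numeral_2_eq_2 algebra_simps)

text \<open>
  A root of \<open>1 + w + \<dots> + w\<^sup>d\<^sup>-\<^sup>1\<close>, rather than some \<open>w \<noteq> 1\<close> with \<open>w\<^sup>d = 1\<close>: the polynomial is not constant for \<open>d \<ge> 2\<close>,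
  and the vanishing of the sum is what makes \<open>e\<^sub>i\<close> vanish.
\<close>
lemma ex_nontrivial_root_of_unity: "2 \<le> d \<Longrightarrow> \<exists>w :: L. (\<Sum>s<d. w ^ s) = 0"
  using alg_closed[of "d - 1" "\<lambda>_. 1"] lessThan_Suc_atMost[of "d - 1"] by auto

definition lift_poly :: "K poly \<Rightarrow> L poly" where "lift_poly p = map_poly to_ac p"

lemma lift_poly_simps: "degree (lift_poly p) = degree p" "coeff (lift_poly p) k = to_ac (coeff p k)"
  by (simp_all add: lift_poly_def degree_map_poly coeff_map_poly)

lemma poly_lift_poly: "poly (lift_poly p) \<theta> = (\<Sum>j\<le>degree p. to_ac (coeff p j) * \<theta> ^ j)"
  by (simp add: poly_altdef lift_poly_simps)

lemma few_roots:
  assumes "p \<noteq> 0" "finite S" "\<And>\<theta>. \<theta> \<in> S \<Longrightarrow> poly (lift_poly p) \<theta> = 0"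
  shows "card S \<le> degree p"
proof -
  have "lift_poly p \<noteq> 0" using assms(1) by (metis lift_poly_simps(2) coeff_0 poly_eqI to_ac_eq_0_iff)
  moreover from this have "card S \<le> card {\<theta>. poly (lift_poly p) \<theta> = 0}"
    using assms(3) by (intro card_mono poly_roots_finite) auto
  ultimately show ?thesis using card_poly_roots_bound[of "lift_poly p"] by (simp add: lift_poly_simps)
qed

abbreviation (input) eval_at :: "K poly \<Rightarrow> nat \<Rightarrow> free_elem"
  where "eval_at p i \<equiv> \<Sum>k\<le>degree p. const (coeff p k) * letter (G i) ^ k"

text \<open>
  Where \<open>c h\<close> acts as zero, the operator \<open>p(g)\<close> vanishes, hence \<open>p(\<theta>) = 0\<close> for every eigenvalue \<open>\<theta>\<close> of \<open>g\<close>. It is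
  enough that \<open>c h v\<close> vanishes at one place where \<open>v\<close> does not.
\<close>
lemma (in linear_letters) eigenvalue_is_root:
  assumes "act (eval_at p i - const c * letter (H i)) v = (\<lambda>k. 0)"
    and "\<rho> (G i) v = (\<lambda>k. \<theta> * v k)" and "to_ac c * \<rho> (H i) v k = 0" and "v k \<noteq> 0"
  shows "poly (lift_poly p) \<theta> = 0"
proof -
  have "act (eval_at p i - const c * letter (H i)) v k = poly (lift_poly p) \<theta> * v k"
    using assms(2,3) by (simp add: act_diff act_eigenvector act_mult act_const act_letter poly_lift_poly)
  then show ?thesis using assms(1,4) by simp
qed

text \<open>
  The eigenvectors are the function supported at \<open>0\<close> and the symmetric and antisymmetric functions
  supported at \<open>{i, i + 1}\<close>.
\<close>
lemma permutation_roots: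
  fixes a \<mu> w :: L
  assumes "1 \<le> d" "1 \<le> i" and root: "a\<^sup>2 + to_ac m\<^sub>K * a - 1 = 0" and mu: "\<mu>\<^sup>2 = 1 - to_ac m\<^sub>K"
    and w: "(\<Sum>s<d. w ^ s) = 0"
    and elem: "eval_at p i - const c * letter (H i) \<in> framization_ideal d n y"
  shows "poly (lift_poly p) a = 0" and "poly (lift_poly p) \<mu> = 0" and "poly (lift_poly p) (- \<mu>) = 0"
proof -
  interpret linear_letters "permutation_gen a \<mu> w"
    by unfold_locales (auto simp: permutation_gen_def algebra_simps split: gen.splits)
  note root = eigenvalue_is_root[OF permutation_acts_zero[OF assms(1) root mu w elem]]
  show "poly (lift_poly p) a = 0"
    by (rule root[where v = "\<lambda>k. if k = 0 then 1 else 0" and k = 0])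
      (use assms in \<open>auto simp: permutation_gen_def\<close>)
  show "poly (lift_poly p) \<mu> = 0"
    by (rule root[where v = "\<lambda>k. if k = i \<or> k = i + 1 then 1 else 0" and k = i])
      (auto simp: permutation_gen_def)
  show "poly (lift_poly p) (- \<mu>) = 0"
    by (rule root[where v = "\<lambda>k. if k = i then 1 else if k = i + 1 then - 1 else 0" and k = i])
      (auto simp: permutation_gen_def)
qed

text \<open>
  The eigenvector is the function spanning the image of \<open>h\<^sub>i\<close>; its value at \<open>(i, i + 1)\<close> is \<open>y\<^sub>K\<close>, which is not zero.
\<close>
lemma arc_root:
  fixes y :: "nat \<Rightarrow> K"
  assumes "1 \<le> d" and root: "a\<^sup>2 + to_ac m\<^sub>K * a - 1 = 0"
    and z: "z ^ d = 1" and y: "\<And>k. k < d \<Longrightarrow> to_ac (y k) = z ^ k * to_ac y\<^sub>K"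
    and elem: "eval_at p i - const 0 * letter (H i) \<in> framization_ideal d n y"
  shows "poly (lift_poly p) (to_ac (inverse l\<^sub>K)) = 0"
proof -
  define b u where "b = a + to_ac m\<^sub>K" and "u = to_ac (inverse l\<^sub>K)"
  interpret linear_letters "arc_rep_gen a b u (to_ac y\<^sub>K) z"
    by unfold_locales
      (auto simp: arc_rep_gen_def algebra_simps arc_gen_add arc_gen_scale split: gen.splits)
  note parameters = arc_parameters(1,3)[OF root, folded b_def u_def]
  have "y\<^sub>K \<noteq> 0"
  proof
    assume "y\<^sub>K = 0"
    then have "1 + m\<^sub>K * l\<^sub>K - l\<^sub>K\<^sup>2 = 0"
      using m_nonzero l_nonzero by (simp add: y\<^sub>K_def field_simps power2_eq_square)
    then show False using K_inequalities by simp
  qed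
  moreover have "arc_coeff a b u (to_ac y\<^sub>K) i (i, Suc i) = to_ac y\<^sub>K"
    by (simp add: arc_coeff_simps)
  ultimately have nonzero: "arc_coeff a b u (to_ac y\<^sub>K) i (i, Suc i) \<noteq> 0" by simp
  show ?thesis
    unfolding u_def[symmetric]
  proof (rule eigenvalue_is_root[where v = "arc_coeff a b u (to_ac y\<^sub>K) i" and c = 0,
          OF _ _ _ nonzero])
    show "act (eval_at p i - const 0 * letter (H i)) (arc_coeff a b u (to_ac y\<^sub>K) i) = (\<lambda>k. 0)"
      using arc_acts_zero[OF assms(1) root z y elem] by (simp add: b_def u_def)
    show "arc_rep_gen a b u (to_ac y\<^sub>K) z (G i) (arc_coeff a b u (to_ac y\<^sub>K) i)
        = (\<lambda>k. u * arc_coeff a b u (to_ac y\<^sub>K) i k)"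
      by (auto simp: arc_rep_gen_def arc_gen_coeff[OF parameters])
  qed simp
qed

text \<open>
  The other root of \<open>x\<^sup>2 + m x - 1\<close> is \<open>- m - a\<close>. A common root with \<open>x\<^sup>2 + m - 1\<close> would satisfy \<open>m (x - 1) = 0\<close>, but
  \<open>1\<close> is a root of neither.
\<close>
lemma four_roots:
  fixes a \<mu> :: L
  assumes root: "a\<^sup>2 + to_ac m\<^sub>K * a - 1 = 0" and mu: "\<mu>\<^sup>2 = 1 - to_ac m\<^sub>K"
  shows "(- to_ac m\<^sub>K - a)\<^sup>2 + to_ac m\<^sub>K * (- to_ac m\<^sub>K - a) - 1 = 0"
    and "card {a, - to_ac m\<^sub>K - a, \<mu>, - \<mu>} = 4"
    and "to_ac (inverse l\<^sub>K) \<notin> {a, - to_ac m\<^sub>K - a, \<mu>, - \<mu>}"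
proof -
  let ?m = "to_ac m\<^sub>K" and ?u = "to_ac (inverse l\<^sub>K)"
  show root': "(- ?m - a)\<^sup>2 + ?m * (- ?m - a) - 1 = 0"
    using root by (simp add: power2_eq_square algebra_simps)
  have m0: "?m \<noteq> 0" "?m \<noteq> 1" "?m\<^sup>2 + 4 \<noteq> 0"
    using m_nonzero K_inequalities(1) K_inequalities(2)
    by (metis to_ac_eq_0_iff, metis to_ac_eq_iff to_ac_1,
        metis to_ac_eq_0_iff to_ac_add to_ac_power to_ac_numeral)
  have "\<mu> \<noteq> 0" using mu m0 by auto
  moreover have "(2 :: L) \<noteq> 0"
    using of_nat_L_eq_0_iff[of 2] by simp
  ultimately have mu': "\<mu> \<noteq> - \<mu>"
    by (metis add_eq_0_iff mult_2 mult_eq_0_iff)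
  have distinct: "x\<^sup>2 \<noteq> 1 - ?m" if "x\<^sup>2 + ?m * x - 1 = 0" for x
  proof
    assume *: "x\<^sup>2 = 1 - ?m"
    with that have "?m * (x - 1) = 0" by (simp add: algebra_simps)
    then have "x = 1" using m0 by simp
    with * m0 show False by simp
  qed
  have "a \<noteq> - ?m - a"
  proof
    assume "a = - ?m - a"
    then have "?m = - 2 * a" by (simp add: algebra_simps)
    with root have "- (a * a) = 1"
      by (simp add: power2_eq_square algebra_simps)
    then have "a * a = - 1"
      by (metis minus_minus)
    then have "?m\<^sup>2 + 4 = 0"
      by (simp add: \<open>?m = - 2 * a\<close> power2_eq_square mult.assoc mult.left_commute)
    with m0(3) show False by simp
  qed
  then show "card {a, - ?m - a, \<mu>, - \<mu>} = 4"
    using mu' distinct[OF root] distinct[OF root'] mu by (auto simp: card_insert_if)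
  have "?u\<^sup>2 + ?m * ?u - 1 \<noteq> 0"
  proof
    assume "?u\<^sup>2 + ?m * ?u - 1 = 0"
    then have "to_ac ((inverse l\<^sub>K)\<^sup>2 + m\<^sub>K * inverse l\<^sub>K - 1) = 0" by simp
    then have "1 + m\<^sub>K * l\<^sub>K - l\<^sub>K\<^sup>2 = 0"
      unfolding to_ac_eq_0_iff using l_nonzero by (simp add: field_simps power2_eq_square)
    then show False using K_inequalities by simp
  qed
  moreover have "?u\<^sup>2 \<noteq> 1 - ?m"
  proof
    assume "?u\<^sup>2 = 1 - ?m"
    then have "to_ac ((inverse l\<^sub>K)\<^sup>2 - 1 + m\<^sub>K) = 0" by simp
    then have "1 - l\<^sub>K\<^sup>2 + m\<^sub>K * l\<^sub>K\<^sup>2 = 0"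
      unfolding to_ac_eq_0_iff using l_nonzero by (simp add: field_simps power2_eq_square)
    then show False using K_inequalities by simp
  qed
  ultimately show "?u \<notin> {a, - ?m - a, \<mu>, - \<mu>}"
    using root root' mu by auto
qed

lemma degree_ge_4:
  assumes "2 \<le> d" "1 \<le> i" "p \<noteq> 0"
    and "eval_at p i - const c * letter (H i) \<in> framization_ideal d n y"
  shows "4 \<le> degree p"
proof -
  obtain a \<mu> w :: L where *: "a\<^sup>2 + to_ac m\<^sub>K * a - 1 = 0" "\<mu>\<^sup>2 = 1 - to_ac m\<^sub>K"
    "(\<Sum>s<d. w ^ s) = 0"
    using ex_quadratic_root ex_sqrt ex_nontrivial_root_of_unity[OF assms(1)] by metis
  note a' = four_roots(1)[OF *(1,2)]
  have "poly (lift_poly p) \<theta> = 0" if "\<theta> \<in> {a, - to_ac m\<^sub>K - a, \<mu>, - \<mu>}" for \<theta>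
    using that assms permutation_roots[OF _ assms(2) *(1) *(2) *(3) assms(4)]
      permutation_roots[OF _ assms(2) a' *(2) *(3) assms(4)] by auto
  with assms(3) have "card {a, - to_ac m\<^sub>K - a, \<mu>, - \<mu>} \<le> degree p"
    by (intro few_roots) simp_all
  then show ?thesis
    using four_roots(2)[OF *(1,2)] by simp
qed

lemma degree_ge_5:
  fixes y :: "nat \<Rightarrow> K"
  assumes "2 \<le> d" "1 \<le> i" "p \<noteq> 0" "y 0 = y\<^sub>K"
    and \<zeta>: "\<zeta> ^ d = 1" "\<And>k. k < d \<Longrightarrow> y k = \<zeta> ^ k * y 0"
    and elem: "eval_at p i - const 0 * letter (H i) \<in> framization_ideal d n y"
  shows "5 \<le> degree p"
proof -
  obtain a \<mu> w :: L where *: "a\<^sup>2 + to_ac m\<^sub>K * a - 1 = 0" "\<mu>\<^sup>2 = 1 - to_ac m\<^sub>K"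
    "(\<Sum>s<d. w ^ s) = 0"
    using ex_quadratic_root ex_sqrt ex_nontrivial_root_of_unity[OF assms(1)] by metis
  note a' = four_roots(1)[OF *(1,2)]
  have order: "to_ac \<zeta> ^ d = 1" using \<zeta>(1) by (metis to_ac_1 to_ac_power)
  have y: "to_ac (y k) = to_ac \<zeta> ^ k * to_ac y\<^sub>K" if "k < d" for k
    using \<zeta>(2)[OF that] assms(4) by simp
  have "poly (lift_poly p) (to_ac (inverse l\<^sub>K)) = 0"
    by (rule arc_root[where z = "to_ac \<zeta>" and y = y, OF _ *(1) order y elem])
      (use assms(1) in simp_all)
  then have roots: "poly (lift_poly p) \<theta> = 0"
    if "\<theta> \<in> insert (to_ac (inverse l\<^sub>K)) {a, - to_ac m\<^sub>K - a, \<mu>, - \<mu>}" for \<theta>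
    using that assms(1) permutation_roots[OF _ assms(2) *(1) *(2) *(3) elem]
      permutation_roots[OF _ assms(2) a' *(2) *(3) elem] by auto
  have "card (insert (to_ac (inverse l\<^sub>K)) {a, - to_ac m\<^sub>K - a, \<mu>, - \<mu>}) \<le> degree p"
    by (rule few_roots[OF assms(3) _ roots]) simp_all
  moreover have "card (insert (to_ac (inverse l\<^sub>K)) {a, - to_ac m\<^sub>K - a, \<mu>, - \<mu>}) = Suc 4"
    using four_roots(3)[OF *(1,2)] unfolding four_roots(2)[OF *(1,2), symmetric]
    by (intro card_insert_disjoint) simp_all
  ultimately show ?thesis by simp
qed

theorem proposition2:
  fixes d n i :: nat
    and y :: "nat \<Rightarrow> K"
    and F (structure)
    and s :: "K \<Rightarrow> free_elem set"
    and g h :: "free_elem set"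
  assumes "1 \<le> d" and "1 \<le> n" and "1 \<le> i" and "i \<le> n - 1"
    and "y 0 = y\<^sub>K"
    and "F = framization d n y"
    and "s = (\<lambda>c. cls d n y (const c))"
    and "g = cls d n y (letter (G i))"
    and "h = cls d n y (letter (H i))"
  shows
    "g [^] (4::nat) \<oplus> s m\<^sub>K \<otimes> g [^] (3::nat) \<oplus> s (m\<^sub>K - 2) \<otimes> g [^] (2::nat)
        \<oplus> s (m\<^sub>K * (m\<^sub>K - 1)) \<otimes> g \<ominus> s (m\<^sub>K - 1)
      = s (m\<^sub>K * inverse l\<^sub>K * (m\<^sub>K + inverse l\<^sub>K ^ 2 - 1)) \<otimes> h
     \<and> (2 \<le> d \<longrightarrow>
          \<not> (\<exists>(p :: K poly) c. p \<noteq> 0 \<and> degree p < 4 \<and> poly_at F s p g = s c \<otimes> h))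
     \<and> (g \<ominus> s (inverse l\<^sub>K)) \<otimes>
        (g [^] (4::nat) \<oplus> s m\<^sub>K \<otimes> g [^] (3::nat) \<oplus> s (m\<^sub>K - 2) \<otimes> g [^] (2::nat)
          \<oplus> s (m\<^sub>K * (m\<^sub>K - 1)) \<otimes> g \<ominus> s (m\<^sub>K - 1)) = \<zero>
     \<and> (2 \<le> d \<and> (\<exists>\<zeta>. \<zeta> ^ d = 1 \<and> (\<forall>k<d. y k = \<zeta> ^ k * y 0)) \<longrightarrow>
          \<not> (\<exists>p :: K poly. p \<noteq> 0 \<and> degree p < 5 \<and> poly_at F s p g = \<zero>))
     \<and> [: - (m\<^sub>K - 1), m\<^sub>K * (m\<^sub>K - 1), m\<^sub>K - 2, m\<^sub>K, 1 :]
        = [: - 1, m\<^sub>K, 1 :] * [: m\<^sub>K - 1, 0, 1 :]"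
    (is "?Q = ?R \<and> ?min4 \<and> ?quintic \<and> ?min5 \<and> ?factor")
proof (intro conjI)
  let ?I = "framization_ideal d n y" and ?cls = "cls d n y"
  let ?x = "letter (G i)" and ?h = "letter (H i)"
  let ?M = "const m\<^sub>K" and ?U = "const (inverse l\<^sub>K)"
  let ?C = "?M * ?U * (?M + ?U\<^sup>2 - 1)"
  have i: "i < n" using assms by auto
  have gens [simp]: "?x \<in> carr n" "?h \<in> carr n"
    using assms i by (auto simp: gens_def)
  interpret ideal_congruence "carr n" ?I by (rule ideal_congruence_framization)
  have two: "const 2 = 2" using const_of_nat[of 2] by simp
  let ?P = "(?x\<^sup>2 + ?M - 1) * (?x\<^sup>2 + ?M * ?x - 1)"
  have expand: "?x ^ 4 + ?M * ?x ^ 3 + const (m\<^sub>K - 2) * ?x ^ 2 + const (m\<^sub>K * (m\<^sub>K - 1)) * ?x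
      - const (m\<^sub>K - 1) = ?P"
    by (simp add: const_diff const_mult const_1 two algebra_simps power2_eq_square
        numeral_3_eq_3 numeral_eq_Suc const_central[of ?x] const_left_commute[of ?x] mult_2)
  have Q: "?Q = ?cls ?P"
    using expand[symmetric] by (simp add: assms(6-9) cls_hom)
  have C: "const (m\<^sub>K * inverse l\<^sub>K * (m\<^sub>K + inverse l\<^sub>K ^ 2 - 1)) = ?C"
    by (simp add: const_diff const_add const_mult const_1 const_power)
  note relation = quartic_relation[OF assms(1) assms(3) i, of y]
  show quartic: "?Q = ?R"
    using relation(1) unfolding Q unfolding assms(6-9) by (simp add: cls_mult cls_eq_iff C)
  show ?quintic
  proof -
    \<comment> \<open>The scalar \<open>?C\<close> moves past \<open>?x - ?U\<close>, which annihilates \<open>?h\<close> modulo the ideal.\<close>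
    have "(?x - ?U) * (?P - ?C * ?h) + ?C * (?x * ?h - ?U * ?h) \<in> ?I"
      by (intro ideal_add ideal_left relation) simp_all
    also have "(?x - ?U) * (?P - ?C * ?h) + ?C * (?x * ?h - ?U * ?h) = (?x - ?U) * ?P"
    proof -
      have "(?x - ?U) * ?C = ?C * (?x - ?U)"
        unfolding C[symmetric] by (simp only: const_central)
      then have "(?x - ?U) * (?C * ?h) = ?C * (?x - ?U) * ?h"
        by (simp only: mult.assoc[symmetric])
      then show ?thesis by (simp only: right_diff_distrib) (simp add: algebra_simps)
    qed
    finally show ?thesis
      unfolding Q by (simp add: assms(6-9) cls_hom cls_eq_iff)
  qed
  have poly_at: "poly_at F s p g = s c \<otimes> h \<longleftrightarrow> eval_at p i - const c * ?h \<in> ?I" for p c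
    unfolding assms(6-9) by (simp add: poly_at_cls cls_mult cls_eq_iff carr_sum)
  show ?min4
  proof (intro impI notI, elim exE conjE)
    fix p c
    assume "2 \<le> d" "p \<noteq> 0" "degree p < 4" "poly_at F s p g = s c \<otimes> h"
    then show False
      using degree_ge_4[of d i p c n y] assms(3) unfolding poly_at by simp
  qed
  have zero: "\<zero> = s 0 \<otimes> h"
    unfolding assms(6-9) by (simp add: cls_hom const_0)
  show ?min5
  proof (intro impI notI, elim exE conjE)
    fix p \<zeta>
    assume p: "2 \<le> d" "p \<noteq> 0" "degree p < 5" "poly_at F s p g = \<zero>"
      and \<zeta>: "\<zeta> ^ d = 1" "\<forall>k<d. y k = \<zeta> ^ k * y 0"
    have elem: "eval_at p i - const 0 * ?h \<in> ?I"
      using p(4) unfolding zero poly_at .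
    have "5 \<le> degree p"
      by (rule degree_ge_5[where y = y, OF p(1) assms(3) p(2) assms(5) \<zeta>(1) _ elem]) (use \<zeta>(2) in blast)
    with p(3) show False by simp
  qed
  show ?factor by (simp add: algebra_simps)
qed

end
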